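(* A geometric morphism $f:\mathcal F\to\mathcal E$ between toposes is totally connected if and only if it is essential and its essential image $f_!:\mathcal F\to\mathcal E$ is a cartesian fibration.
   Context: Topos means Grothendieck topos. A geometric morphism $f:\mathcal F\to\mathcal E$ is essential if $f^*$ has a left adjoint $f_!$ (the essential image). It is locally connected if it is essential and the functors $\mathcal F/f^*(E)\to\mathcal E/E$ sending $\alpha:F\to f^*(E)$ to its transpose $f_!(F)\to E$ form an $\mathcal E$-indexed functor, i.e. commute up to the canonical isomorphism with the pullback functors along $f^*(h)$ and $h$ for every arrow $h:E'\to E$ in $\mathcal E$. It is totally connected if it is locally connected and $f_!$ preserves finite limits. Fibration means Street fibration: a functor $p:\mathcal D\to\mathcal C$ such that for every arrow $u:c\to p(d)$ there are a cartesian arrow $\widehat u:d'\to d$ and an isomorphism $\sigma:p(d')\simeq c$ with $p(\widehat u)=u\sigma$, where $v:d'\to d$ is cartesian if for all $g:d''\to d$ and $h:p(d'')\to p(d')$ with $p(v)h=p(g)$ there is a unique $h':d''\to d'$ with $p(h')=h$ and $vh'=g$. For a category $\mathcal C$ with finite limits, a fibration $p:\mathcal D\to\mathcal C$ is a cartesian fibration if $\mathcal D$ has finite limits and $p$ preserves them. *)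

theory Defs
  imports "HOL-Library.FuncSet"
begin

unbundle cardinal_syntax

section \<open>Categories, functors, natural transformations\<close>

record ('o, 'm) cat =
  Obj :: "'o set"
  Arr :: "'m set"
  Dom :: "'m \<Rightarrow> 'o"
  Cod :: "'m \<Rightarrow> 'o"
  Ident :: "'o \<Rightarrow> 'm"
  Comp :: "'m \<Rightarrow> 'm \<Rightarrow> 'm" (infixr "\<cdot>\<index>" 75)

definition Hom :: "('o, 'm) cat \<Rightarrow> 'o \<Rightarrow> 'o \<Rightarrow> 'm set" where
  "Hom C a b = {f \<in> Arr C. Dom C f = a \<and> Cod C f = b}"

locale category =
  fixes C :: "('o, 'm) cat" (structure)
  assumes Dom_Obj: "f \<in> Arr C \<Longrightarrow> Dom C f \<in> Obj C"
    and Cod_Obj: "f \<in> Arr C \<Longrightarrow> Cod C f \<in> Obj C"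
    and Ident_Hom: "a \<in> Obj C \<Longrightarrow> Ident C a \<in> Hom C a a"
    and Comp_Hom: "f \<in> Hom C a b \<Longrightarrow> g \<in> Hom C b c \<Longrightarrow> g \<cdot> f \<in> Hom C a c"
    and Comp_Ident: "f \<in> Arr C \<Longrightarrow> f \<cdot> Ident C (Dom C f) = f"
    and Ident_Comp: "f \<in> Arr C \<Longrightarrow> Ident C (Cod C f) \<cdot> f = f"
    and Comp_assoc: "f \<in> Hom C a b \<Longrightarrow> g \<in> Hom C b c \<Longrightarrow> h \<in> Hom C c d
           \<Longrightarrow> (h \<cdot> g) \<cdot> f = h \<cdot> (g \<cdot> f)"

definition is_iso :: "('o, 'm) cat \<Rightarrow> 'm \<Rightarrow> bool" where
  "is_iso C f \<longleftrightarrow> f \<in> Arr C \<and>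
     (\<exists>g \<in> Hom C (Cod C f) (Dom C f).
        g \<cdot>\<^bsub>C\<^esub> f = Ident C (Dom C f) \<and> f \<cdot>\<^bsub>C\<^esub> g = Ident C (Cod C f))"

definition op_cat :: "('o, 'm) cat \<Rightarrow> ('o, 'm) cat" where
  "op_cat C = \<lparr>Obj = Obj C, Arr = Arr C, Dom = Cod C, Cod = Dom C, Ident = Ident C,
     Comp = (\<lambda>g f. f \<cdot>\<^bsub>C\<^esub> g)\<rparr>"

record ('o, 'm, 'p, 'n) func =
  FO :: "'o \<Rightarrow> 'p"
  FM :: "'m \<Rightarrow> 'n"

definition is_functor :: "('o, 'm) cat \<Rightarrow> ('p, 'n) cat \<Rightarrow> ('o, 'm, 'p, 'n) func \<Rightarrow> bool" where
  "is_functor C D T \<longleftrightarrow> category C \<and> category D \<and>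
     (\<forall>a \<in> Obj C. FO T a \<in> Obj D) \<and>
     (\<forall>f \<in> Arr C. FM T f \<in> Hom D (FO T (Dom C f)) (FO T (Cod C f))) \<and>
     (\<forall>a \<in> Obj C. FM T (Ident C a) = Ident D (FO T a)) \<and>
     (\<forall>f \<in> Arr C. \<forall>g \<in> Arr C. Cod C f = Dom C g \<longrightarrow>
        FM T (g \<cdot>\<^bsub>C\<^esub> f) = FM T g \<cdot>\<^bsub>D\<^esub> FM T f)"

definition id_func :: "('o, 'm, 'o, 'm) func" where
  "id_func = \<lparr>FO = (\<lambda>a. a), FM = (\<lambda>f. f)\<rparr>"

definition comp_func ::
    "('p, 'n, 'q, 'l) func \<Rightarrow> ('o, 'm, 'p, 'n) func \<Rightarrow> ('o, 'm, 'q, 'l) func" where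
  "comp_func S T = \<lparr>FO = (\<lambda>a. FO S (FO T a)), FM = (\<lambda>f. FM S (FM T f))\<rparr>"

definition nat_trans :: "('o, 'm) cat \<Rightarrow> ('p, 'n) cat \<Rightarrow>
    ('o, 'm, 'p, 'n) func \<Rightarrow> ('o, 'm, 'p, 'n) func \<Rightarrow> ('o \<Rightarrow> 'n) \<Rightarrow> bool" where
  "nat_trans C D S T \<eta> \<longleftrightarrow> is_functor C D S \<and> is_functor C D T \<and>
     (\<forall>a \<in> Obj C. \<eta> a \<in> Hom D (FO S a) (FO T a)) \<and>
     (\<forall>f \<in> Arr C. \<eta> (Cod C f) \<cdot>\<^bsub>D\<^esub> FM S f = FM T f \<cdot>\<^bsub>D\<^esub> \<eta> (Dom C f))"

definition nat_iso :: "('o, 'm) cat \<Rightarrow> ('p, 'n) cat \<Rightarrow>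
    ('o, 'm, 'p, 'n) func \<Rightarrow> ('o, 'm, 'p, 'n) func \<Rightarrow> ('o \<Rightarrow> 'n) \<Rightarrow> bool" where
  "nat_iso C D S T \<eta> \<longleftrightarrow> nat_trans C D S T \<eta> \<and> (\<forall>a \<in> Obj C. is_iso D (\<eta> a))"

definition equivalent :: "('o, 'm) cat \<Rightarrow> ('p, 'n) cat \<Rightarrow> bool" where
  "equivalent C D \<longleftrightarrow> (\<exists>S T \<eta> \<epsilon>.
     is_functor C D S \<and> is_functor D C T \<and>
     nat_iso C C id_func (comp_func T S) \<eta> \<and> nat_iso D D (comp_func S T) id_func \<epsilon>)"

text \<open>\<open>L : C \<rightarrow> D\<close> is left adjoint to \<open>R : D \<rightarrow> C\<close>
  with unit \<open>\<eta>\<close> and counit \<open>\<epsilon>\<close>.\<close>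

definition adjunction :: "('o, 'm) cat \<Rightarrow> ('p, 'n) cat \<Rightarrow> ('o, 'm, 'p, 'n) func \<Rightarrow>
    ('p, 'n, 'o, 'm) func \<Rightarrow> ('o \<Rightarrow> 'm) \<Rightarrow> ('p \<Rightarrow> 'n) \<Rightarrow> bool" where
  "adjunction C D L R \<eta> \<epsilon> \<longleftrightarrow> is_functor C D L \<and> is_functor D C R \<and>
     nat_trans C C id_func (comp_func R L) \<eta> \<and>
     nat_trans D D (comp_func L R) id_func \<epsilon> \<and>
     (\<forall>a \<in> Obj C. \<epsilon> (FO L a) \<cdot>\<^bsub>D\<^esub> FM L (\<eta> a) = Ident D (FO L a)) \<and>
     (\<forall>b \<in> Obj D. FM R (\<epsilon> b) \<cdot>\<^bsub>C\<^esub> \<eta> (FO R b) = Ident C (FO R b))"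


section \<open>Finite limits\<close>

definition is_cone :: "('j, 'k) cat \<Rightarrow> ('o, 'm) cat \<Rightarrow> ('j, 'k, 'o, 'm) func \<Rightarrow>
    'o \<Rightarrow> ('j \<Rightarrow> 'm) \<Rightarrow> bool" where
  "is_cone J C T x \<pi> \<longleftrightarrow> x \<in> Obj C \<and>
     (\<forall>j \<in> Obj J. \<pi> j \<in> Hom C x (FO T j)) \<and>
     (\<forall>k \<in> Arr J. FM T k \<cdot>\<^bsub>C\<^esub> \<pi> (Dom J k) = \<pi> (Cod J k))"

definition is_limit :: "('j, 'k) cat \<Rightarrow> ('o, 'm) cat \<Rightarrow> ('j, 'k, 'o, 'm) func \<Rightarrow>
    'o \<Rightarrow> ('j \<Rightarrow> 'm) \<Rightarrow> bool" where
  "is_limit J C T x \<pi> \<longleftrightarrow> is_cone J C T x \<pi> \<and>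
     (\<forall>y \<mu>. is_cone J C T y \<mu> \<longrightarrow>
        (\<exists>!u. u \<in> Hom C y x \<and> (\<forall>j \<in> Obj J. \<pi> j \<cdot>\<^bsub>C\<^esub> u = \<mu> j)))"

text \<open>Every finite category is isomorphic to one whose objects and arrows are natural
  numbers, so these suffice as shapes of finite diagrams.\<close>

definition finite_category :: "(nat, nat) cat \<Rightarrow> bool" where
  "finite_category J \<longleftrightarrow> category J \<and> finite (Obj J) \<and> finite (Arr J)"

definition has_finite_limits :: "('o, 'm) cat \<Rightarrow> bool" where
  "has_finite_limits C \<longleftrightarrow>
     (\<forall>J T. finite_category J \<and> is_functor J C T \<longrightarrow> (\<exists>x \<pi>. is_limit J C T x \<pi>))"

definition preserves_finite_limits ::
    "('o, 'm) cat \<Rightarrow> ('p, 'n) cat \<Rightarrow> ('o, 'm, 'p, 'n) func \<Rightarrow> bool" where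
  "preserves_finite_limits C D S \<longleftrightarrow>
     (\<forall>J T x \<pi>. finite_category J \<and> is_functor J C T \<and> is_limit J C T x \<pi> \<longrightarrow>
        is_limit J D (comp_func S T) (FO S x) (\<lambda>j. FM S (\<pi> j)))"

definition is_pullback :: "('o, 'm) cat \<Rightarrow> 'm \<Rightarrow> 'm \<Rightarrow> 'm \<Rightarrow> 'm \<Rightarrow> bool" where
  "is_pullback C f g p q \<longleftrightarrow>
     f \<in> Arr C \<and> g \<in> Arr C \<and> p \<in> Arr C \<and> q \<in> Arr C \<and>
     Cod C f = Cod C g \<and> Dom C p = Dom C q \<and> Cod C p = Dom C f \<and> Cod C q = Dom C g \<and>
     f \<cdot>\<^bsub>C\<^esub> p = g \<cdot>\<^bsub>C\<^esub> q \<and>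
     (\<forall>s \<in> Arr C. \<forall>t \<in> Arr C.
        Dom C s = Dom C t \<and> Cod C s = Dom C f \<and> Cod C t = Dom C g \<and>
        f \<cdot>\<^bsub>C\<^esub> s = g \<cdot>\<^bsub>C\<^esub> t \<longrightarrow>
        (\<exists>!u. u \<in> Hom C (Dom C s) (Dom C p) \<and> p \<cdot>\<^bsub>C\<^esub> u = s \<and> q \<cdot>\<^bsub>C\<^esub> u = t))"


section \<open>Grothendieck toposes\<close>

text \<open>Smallness is relative to a type \<open>'u\<close> that plays the role of a Grothendieck
  universe: a small set is, up to bijection, a subset of \<open>'u\<close> of cardinality less than
  that of \<open>'u\<close>. The closure conditions say that the cardinality of \<open>'u\<close> is infinite,
  regular and a strong limit. As in SGA 4 a universe is not required to contain an
  infinite set; requiring \<open>'u\<close> to be uncountable in addition gives exactly the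
  (strongly) inaccessible cardinals.\<close>

definition small :: "'u set \<Rightarrow> bool" where
  "small A \<longleftrightarrow> |A| <o |UNIV :: 'u set|"

definition universe_type :: "'u itself \<Rightarrow> bool" where
  "universe_type _ \<longleftrightarrow> infinite (UNIV :: 'u set) \<and>
     (\<forall>(A :: 'u set) (B :: 'u \<Rightarrow> 'u set). small A \<longrightarrow> (\<forall>a \<in> A. small (B a)) \<longrightarrow>
        small (\<Union>a \<in> A. B a)) \<and>
     (\<forall>A :: 'u set. small A \<longrightarrow> |Pow A| <o |UNIV :: 'u set| )"

text \<open>An arrow of the category of small sets is a triple of source, underlying
  function (extensional on the source) and target.\<close>

type_synonym 'u smap = "'u set \<times> ('u \<Rightarrow> 'u) \<times> 'u set"

definition app :: "'u smap \<Rightarrow> 'u \<Rightarrow> 'u" where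
  "app f = fst (snd f)"

definition set_cat :: "('u set, 'u smap) cat" where
  "set_cat = \<lparr>Obj = {A. small A},
     Arr = {(A, f, B). small A \<and> small B \<and> f \<in> A \<rightarrow>\<^sub>E B},
     Dom = fst, Cod = (\<lambda>f. snd (snd f)),
     Ident = (\<lambda>A. (A, (\<lambda>x \<in> A. x), A)),
     Comp = (\<lambda>g f. (fst f, compose (fst f) (app g) (app f), snd (snd g)))\<rparr>"

text \<open>Every small category is isomorphic to one whose objects and arrows are elements of
  \<open>'u\<close>; so small sites may be assumed to be of this form.\<close>

definition small_category :: "('u, 'u) cat \<Rightarrow> bool" where
  "small_category C \<longleftrightarrow> category C \<and> small (Obj C) \<and> small (Arr C)"

definition is_sieve :: "('o, 'm) cat \<Rightarrow> 'o \<Rightarrow> 'm set \<Rightarrow> bool" where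
  "is_sieve C c S \<longleftrightarrow> S \<subseteq> {f \<in> Arr C. Cod C f = c} \<and>
     (\<forall>f \<in> S. \<forall>g \<in> Arr C. Cod C g = Dom C f \<longrightarrow> f \<cdot>\<^bsub>C\<^esub> g \<in> S)"

definition pullback_sieve :: "('o, 'm) cat \<Rightarrow> 'm \<Rightarrow> 'm set \<Rightarrow> 'm set" where
  "pullback_sieve C h S = {g \<in> Arr C. Cod C g = Dom C h \<and> h \<cdot>\<^bsub>C\<^esub> g \<in> S}"

definition grothendieck_topology :: "('o, 'm) cat \<Rightarrow> ('o \<Rightarrow> 'm set set) \<Rightarrow> bool" where
  "grothendieck_topology C K \<longleftrightarrow>
     (\<forall>c \<in> Obj C. \<forall>S \<in> K c. is_sieve C c S) \<and>
     (\<forall>c \<in> Obj C. {f \<in> Arr C. Cod C f = c} \<in> K c) \<and>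
     (\<forall>h \<in> Arr C. \<forall>S \<in> K (Cod C h). pullback_sieve C h S \<in> K (Dom C h)) \<and>
     (\<forall>c \<in> Obj C. \<forall>S \<in> K c. \<forall>R. is_sieve C c R \<and>
        (\<forall>f \<in> S. pullback_sieve C f R \<in> K (Dom C f)) \<longrightarrow> R \<in> K c)"

type_synonym ('o, 'm, 'u) presheaf = "('o, 'm, 'u set, 'u smap) func"

definition is_presheaf :: "('o, 'm) cat \<Rightarrow> ('o, 'm, 'u) presheaf \<Rightarrow> bool" where
  "is_presheaf C P \<longleftrightarrow> is_functor (op_cat C) set_cat P"

definition matching_family :: "('o, 'm) cat \<Rightarrow> ('o, 'm, 'u) presheaf \<Rightarrow> 'm set \<Rightarrow>
    ('m \<Rightarrow> 'u) \<Rightarrow> bool" where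
  "matching_family C P S x \<longleftrightarrow>
     (\<forall>f \<in> S. x f \<in> FO P (Dom C f)) \<and>
     (\<forall>f \<in> S. \<forall>g \<in> Arr C. Cod C g = Dom C f \<longrightarrow>
        app (FM P g) (x f) = x (f \<cdot>\<^bsub>C\<^esub> g))"

definition is_sheaf :: "('o, 'm) cat \<Rightarrow> ('o \<Rightarrow> 'm set set) \<Rightarrow> ('o, 'm, 'u) presheaf \<Rightarrow> bool" where
  "is_sheaf C K P \<longleftrightarrow> is_presheaf C P \<and>
     (\<forall>c \<in> Obj C. \<forall>S \<in> K c. \<forall>x. matching_family C P S x \<longrightarrow>
        (\<exists>!y. y \<in> FO P c \<and> (\<forall>f \<in> S. app (FM P f) y = x f)))"

text \<open>Natural transformations are made extensional on \<open>Obj C\<close> so that parallel arrows with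
  the same components are equal. Two sheaves that differ only outside \<open>C\<close> are
  distinct but isomorphic objects, which is harmless since only the category up to
  equivalence is used.\<close>

definition sheaf_cat :: "('o, 'm) cat \<Rightarrow> ('o \<Rightarrow> 'm set set) \<Rightarrow>
    (('o, 'm, 'u) presheaf,
     ('o, 'm, 'u) presheaf \<times> ('o \<Rightarrow> 'u smap) \<times> ('o, 'm, 'u) presheaf) cat" where
  "sheaf_cat C K = \<lparr>Obj = {P. is_sheaf C K P},
     Arr = {(P, \<alpha>, Q). is_sheaf C K P \<and> is_sheaf C K Q \<and>
              nat_trans (op_cat C) set_cat P Q \<alpha> \<and> \<alpha> \<in> extensional (Obj C)},
     Dom = fst, Cod = (\<lambda>a. snd (snd a)),
     Ident = (\<lambda>P. (P, (\<lambda>c \<in> Obj C. Ident set_cat (FO P c)), P)),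
     Comp = (\<lambda>b a. (fst a,
       (\<lambda>c \<in> Obj C. fst (snd b) c \<cdot>\<^bsub>set_cat\<^esub> fst (snd a) c), snd (snd b)))\<rparr>"

definition grothendieck_topos :: "'u itself \<Rightarrow> ('o, 'm) cat \<Rightarrow> bool" where
  "grothendieck_topos _ E \<longleftrightarrow> category E \<and>
     (\<exists>(C :: ('u, 'u) cat) K. small_category C \<and> grothendieck_topology C K \<and>
        equivalent E (sheaf_cat C K ::
          (('u, 'u, 'u) presheaf,
           ('u, 'u, 'u) presheaf \<times> ('u \<Rightarrow> 'u smap) \<times> ('u, 'u, 'u) presheaf) cat))"


section \<open>Geometric morphisms\<close>

record ('p, 'n, 'o, 'm) geom =
  inv_im :: "('o, 'm, 'p, 'n) func"
  dir_im :: "('p, 'n, 'o, 'm) func"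

definition geometric_morphism ::
    "('p, 'n) cat \<Rightarrow> ('o, 'm) cat \<Rightarrow> ('p, 'n, 'o, 'm) geom \<Rightarrow> bool" where
  "geometric_morphism F E f \<longleftrightarrow>
     (\<exists>\<eta> \<epsilon>. adjunction E F (inv_im f) (dir_im f) \<eta> \<epsilon>) \<and>
     preserves_finite_limits E F (inv_im f)"

definition essential ::
    "('p, 'n) cat \<Rightarrow> ('o, 'm) cat \<Rightarrow> ('p, 'n, 'o, 'm) geom \<Rightarrow> bool" where
  "essential F E f \<longleftrightarrow> (\<exists>L \<eta> \<epsilon>. adjunction F E L (inv_im f) \<eta> \<epsilon>)"

text \<open>For essential \<open>f\<close>, the left adjoint \<open>f\<^sub>!\<close> of \<open>f\<^sup>*\<close>, which is determined up to
  isomorphism, is chosen together with the unit and counit of the adjunction.\<close>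

definition shriek_adj :: "('p, 'n) cat \<Rightarrow> ('o, 'm) cat \<Rightarrow> ('p, 'n, 'o, 'm) geom \<Rightarrow>
    ('p, 'n, 'o, 'm) func \<times> ('p \<Rightarrow> 'n) \<times> ('o \<Rightarrow> 'm)" where
  "shriek_adj F E f = (SOME (L, \<eta>, \<epsilon>). adjunction F E L (inv_im f) \<eta> \<epsilon>)"

definition shriek :: "('p, 'n) cat \<Rightarrow> ('o, 'm) cat \<Rightarrow> ('p, 'n, 'o, 'm) geom \<Rightarrow>
    ('p, 'n, 'o, 'm) func" where
  "shriek F E f = fst (shriek_adj F E f)"

definition shriek_counit :: "('p, 'n) cat \<Rightarrow> ('o, 'm) cat \<Rightarrow> ('p, 'n, 'o, 'm) geom \<Rightarrow>
    'o \<Rightarrow> 'm" where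
  "shriek_counit F E f = snd (snd (shriek_adj F E f))"

definition slice :: "('o, 'm) cat \<Rightarrow> 'o \<Rightarrow> ('m, 'm \<times> 'm \<times> 'm) cat" where
  "slice C x = \<lparr>Obj = {a \<in> Arr C. Cod C a = x},
     Arr = {(a, m, b). a \<in> Arr C \<and> Cod C a = x \<and> b \<in> Arr C \<and> Cod C b = x \<and>
              m \<in> Hom C (Dom C a) (Dom C b) \<and> b \<cdot>\<^bsub>C\<^esub> m = a},
     Dom = fst, Cod = (\<lambda>t. snd (snd t)),
     Ident = (\<lambda>a. (a, Ident C (Dom C a), a)),
     Comp = (\<lambda>t s. (fst s, fst (snd t) \<cdot>\<^bsub>C\<^esub> fst (snd s), snd (snd t)))\<rparr>"

text \<open>The transpose \<open>f\<^sub>!(x) \<rightarrow> e\<close> of \<open>\<alpha> : x \<rightarrow> f\<^sup>*(e)\<close>, and the functor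
  \<open>F/f\<^sup>*(e) \<rightarrow> E/e\<close> it defines.\<close>

definition shriek_transpose :: "('p, 'n) cat \<Rightarrow> ('o, 'm) cat \<Rightarrow>
    ('p, 'n, 'o, 'm) geom \<Rightarrow> 'o \<Rightarrow> 'n \<Rightarrow> 'm" where
  "shriek_transpose F E f e \<alpha> = shriek_counit F E f e \<cdot>\<^bsub>E\<^esub> FM (shriek F E f) \<alpha>"

definition slice_shriek :: "('p, 'n) cat \<Rightarrow> ('o, 'm) cat \<Rightarrow> ('p, 'n, 'o, 'm) geom \<Rightarrow> 'o \<Rightarrow>
    ('n, 'n \<times> 'n \<times> 'n, 'm, 'm \<times> 'm \<times> 'm) func" where
  "slice_shriek F E f e = \<lparr>FO = shriek_transpose F E f e,
     FM = (\<lambda>(a, m, b). (shriek_transpose F E f e a, FM (shriek F E f) m,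
                          shriek_transpose F E f e b))\<rparr>"

definition pb :: "('o, 'm) cat \<Rightarrow> 'm \<Rightarrow> 'm \<Rightarrow> 'm \<times> 'm" where
  "pb C h a = (SOME (p, q). is_pullback C a h p q)"

abbreviation pb1 :: "('o, 'm) cat \<Rightarrow> 'm \<Rightarrow> 'm \<Rightarrow> 'm" where
  "pb1 C h a \<equiv> fst (pb C h a)"

abbreviation pb2 :: "('o, 'm) cat \<Rightarrow> 'm \<Rightarrow> 'm \<Rightarrow> 'm" where
  "pb2 C h a \<equiv> snd (pb C h a)"

text \<open>The pullback functor \<open>C/Cod h \<rightarrow> C/Dom h\<close> for chosen pullbacks.\<close>

definition pb_func :: "('o, 'm) cat \<Rightarrow> 'm \<Rightarrow>
    ('m, 'm \<times> 'm \<times> 'm, 'm, 'm \<times> 'm \<times> 'm) func" where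
  "pb_func C h = \<lparr>FO = pb2 C h,
     FM = (\<lambda>(a, m, b). (pb2 C h a,
       (THE n. n \<in> Hom C (Dom C (pb2 C h a)) (Dom C (pb2 C h b)) \<and>
          pb1 C h b \<cdot>\<^bsub>C\<^esub> n = m \<cdot>\<^bsub>C\<^esub> pb1 C h a \<and> pb2 C h b \<cdot>\<^bsub>C\<^esub> n = pb2 C h a),
       pb2 C h b))\<rparr>"

text \<open>For \<open>h : e' \<rightarrow> e\<close> in \<open>E\<close> and \<open>\<alpha> : x \<rightarrow> f\<^sup>*(e)\<close> in \<open>F\<close>, the canonical arrow over \<open>e'\<close>
  from \<open>f\<^sub>!(x \<times> f\<^sup>*(e'))\<close> to \<open>f\<^sub>!(x) \<times> e'\<close>, the fibre products being taken over
  \<open>f\<^sup>*(e)\<close> and \<open>e\<close> respectively.\<close>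

definition comparison :: "('p, 'n) cat \<Rightarrow> ('o, 'm) cat \<Rightarrow> ('p, 'n, 'o, 'm) geom \<Rightarrow>
    'm \<Rightarrow> 'n \<Rightarrow> 'm \<times> 'm \<times> 'm" where
  "comparison F E f h \<alpha> =
     (let p = pb1 F (FM (inv_im f) h) \<alpha>;
          q = pb2 F (FM (inv_im f) h) \<alpha>;
          \<alpha>' = shriek_transpose F E f (Cod E h) \<alpha>;
          q' = shriek_transpose F E f (Dom E h) q
      in (q',
          (THE m. m \<in> Hom E (FO (shriek F E f) (Dom F q)) (Dom E (pb2 E h \<alpha>')) \<and>
             pb1 E h \<alpha>' \<cdot>\<^bsub>E\<^esub> m = FM (shriek F E f) p \<and> pb2 E h \<alpha>' \<cdot>\<^bsub>E\<^esub> m = q'),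
          pb2 E h \<alpha>'))"

definition locally_connected ::
    "('p, 'n) cat \<Rightarrow> ('o, 'm) cat \<Rightarrow> ('p, 'n, 'o, 'm) geom \<Rightarrow> bool" where
  "locally_connected F E f \<longleftrightarrow> essential F E f \<and>
     (\<forall>h \<in> Arr E.
        nat_iso (slice F (FO (inv_im f) (Cod E h))) (slice E (Dom E h))
          (comp_func (slice_shriek F E f (Dom E h)) (pb_func F (FM (inv_im f) h)))
          (comp_func (pb_func E h) (slice_shriek F E f (Cod E h)))
          (comparison F E f h))"

definition totally_connected ::
    "('p, 'n) cat \<Rightarrow> ('o, 'm) cat \<Rightarrow> ('p, 'n, 'o, 'm) geom \<Rightarrow> bool" where
  "totally_connected F E f \<longleftrightarrow>
     locally_connected F E f \<and> preserves_finite_limits F E (shriek F E f)"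


section \<open>Street fibrations\<close>

definition cartesian_arrow :: "('p, 'n) cat \<Rightarrow> ('o, 'm) cat \<Rightarrow> ('p, 'n, 'o, 'm) func \<Rightarrow>
    'n \<Rightarrow> bool" where
  "cartesian_arrow D C P v \<longleftrightarrow> v \<in> Arr D \<and>
     (\<forall>g h. g \<in> Arr D \<and> Cod D g = Cod D v \<and>
        h \<in> Hom C (FO P (Dom D g)) (FO P (Dom D v)) \<and> FM P v \<cdot>\<^bsub>C\<^esub> h = FM P g \<longrightarrow>
        (\<exists>!h'. h' \<in> Hom D (Dom D g) (Dom D v) \<and> FM P h' = h \<and> v \<cdot>\<^bsub>D\<^esub> h' = g))"

definition street_fibration ::
    "('p, 'n) cat \<Rightarrow> ('o, 'm) cat \<Rightarrow> ('p, 'n, 'o, 'm) func \<Rightarrow> bool" where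
  "street_fibration D C P \<longleftrightarrow> is_functor D C P \<and>
     (\<forall>d \<in> Obj D. \<forall>u \<in> Arr C. Cod C u = FO P d \<longrightarrow>
        (\<exists>v \<sigma>. cartesian_arrow D C P v \<and> Cod D v = d \<and>
           \<sigma> \<in> Hom C (FO P (Dom D v)) (Dom C u) \<and> is_iso C \<sigma> \<and>
           FM P v = u \<cdot>\<^bsub>C\<^esub> \<sigma>))"

definition cartesian_fibration ::
    "('p, 'n) cat \<Rightarrow> ('o, 'm) cat \<Rightarrow> ('p, 'n, 'o, 'm) func \<Rightarrow> bool" where
  "cartesian_fibration D C P \<longleftrightarrow> has_finite_limits C \<and> street_fibration D C P \<and>
     has_finite_limits D \<and> preserves_finite_limits D C P"

end

theory Submission
  imports Defs
begin

text \<open>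
  Write \<open>L \<stileturn> R\<close> for the adjunction between \<open>f\<^sub>!\<close> and \<open>f\<^sup>*\<close>. Both sides of the equivalence
  ask that \<open>L\<close> preserve finite limits, so its content is that, for an essential \<open>f\<close>, local
  connectedness says exactly that \<open>L\<close> is a fibration. The link is a description of cartesian
  arrows as pullbacks.

  Given \<open>u : c \<rightarrow> L d\<close>, the candidate for a cartesian lift is the pullback \<open>v : d' \<rightarrow> d\<close> of \<open>R u\<close>
  along the unit \<open>d \<rightarrow> R (L d)\<close>, with second projection \<open>q : d' \<rightarrow> R c\<close>. Let \<open>\<sigma> : L d' \<rightarrow> c\<close> be
  the transpose of \<open>q\<close>; then \<open>L v = u \<sigma>\<close>. Mapping into the pullback and
  transposing shows that \<open>v\<close> is cartesian as soon as \<open>\<sigma>\<close> is invertible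
  (\<open>pullback_along_unit_cartesian\<close>). Now \<open>\<sigma>\<close> is, up to isomorphism, the comparison arrow for \<open>u\<close>
  and the unit at \<open>d\<close>, because the transpose of the unit is an identity. Hence local
  connectedness yields a fibration.

  Conversely let \<open>\<alpha> : x \<rightarrow> R e\<close> have transpose \<open>a : L x \<rightarrow> e\<close>, let \<open>h : e' \<rightarrow> e\<close>, and form the
  pullback of \<open>a\<close> and \<open>h\<close> in \<open>E\<close> with projections \<open>u\<close> to \<open>L x\<close> and \<open>w\<close> to \<open>e'\<close>. If \<open>v : d' \<rightarrow> x\<close> is
  a cartesian arrow with \<open>L v = u \<sigma>\<close> and \<open>\<sigma>\<close> invertible, then \<open>v\<close> and the transpose of \<open>w \<sigma>\<close> form
  a pullback of \<open>\<alpha>\<close> and \<open>R h\<close> in \<open>F\<close> (\<open>cartesian_lift_pullback\<close>): arrows into \<open>d'\<close> are arrows into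
  \<open>x\<close> with a factorisation of their images through \<open>u\<close>. For this pullback the comparison arrow
  is \<open>\<sigma>\<close>, so it is invertible for every choice of pullbacks.

  A cartesian fibration moreover has finite limits in both categories, so the argument includes
  that a Grothendieck topos has them. Limits of sheaves are computed pointwise
  (\<open>finite_sheaf_diagram.limit\<close>) and carried along an equivalence (\<open>limit_if_equivalent\<close>).
\<close>

section \<open>Categories, functors and pullbacks\<close>

context category
begin

lemma Ident_Arr [simp]: "a \<in> Obj C \<Longrightarrow> Ident C a \<in> Arr C"
  and Dom_Ident [simp]: "a \<in> Obj C \<Longrightarrow> Dom C (Ident C a) = a"
  and Cod_Ident [simp]: "a \<in> Obj C \<Longrightarrow> Cod C (Ident C a) = a"
  using Ident_Hom by (auto simp: Hom_def)

lemma Comp_Arr [simp]: "\<lbrakk>f \<in> Arr C; g \<in> Arr C; Cod C f = Dom C g\<rbrakk> \<Longrightarrow> g \<cdot> f \<in> Arr C"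
  and Dom_Comp [simp]: "\<lbrakk>f \<in> Arr C; g \<in> Arr C; Cod C f = Dom C g\<rbrakk> \<Longrightarrow> Dom C (g \<cdot> f) = Dom C f"
  and Cod_Comp [simp]: "\<lbrakk>f \<in> Arr C; g \<in> Arr C; Cod C f = Dom C g\<rbrakk> \<Longrightarrow> Cod C (g \<cdot> f) = Cod C g"
  using Comp_Hom[of f "Dom C f" "Cod C f" g "Cod C g"] by (auto simp: Hom_def)

text \<open>Composites are normalised to right-nested form; a step that needs another bracketing therefore
  applies this rule explicitly.\<close>

lemma assoc [simp]:
  "\<lbrakk>f \<in> Arr C; g \<in> Arr C; h \<in> Arr C; Cod C f = Dom C g; Cod C g = Dom C h\<rbrakk>
     \<Longrightarrow> (h \<cdot> g) \<cdot> f = h \<cdot> (g \<cdot> f)"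
  using Comp_assoc[of f "Dom C f" "Cod C f" g "Cod C g" h "Cod C h"] by (auto simp: Hom_def)

lemma Dom_Cod_Obj [simp]: "f \<in> Arr C \<Longrightarrow> Dom C f \<in> Obj C" "f \<in> Arr C \<Longrightarrow> Cod C f \<in> Obj C"
  by (auto intro: Dom_Obj Cod_Obj)

lemma unit_laws [simp]:
  "\<lbrakk>f \<in> Arr C; a = Dom C f\<rbrakk> \<Longrightarrow> f \<cdot> Ident C a = f"
  "\<lbrakk>f \<in> Arr C; a = Cod C f\<rbrakk> \<Longrightarrow> Ident C a \<cdot> f = f"
  by (auto intro: Comp_Ident Ident_Comp)

lemma isoI:
  assumes "f \<in> Arr C" "g \<in> Arr C" "Dom C g = Cod C f" "Cod C g = Dom C f"
    "g \<cdot> f = Ident C (Dom C f)" "f \<cdot> g = Ident C (Cod C f)"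
  shows "is_iso C f"
  using assms by (auto simp: is_iso_def Hom_def)

lemma isoE:
  assumes "is_iso C f"
  obtains g where "f \<in> Arr C" "g \<in> Arr C" "Dom C g = Cod C f" "Cod C g = Dom C f"
    "g \<cdot> f = Ident C (Dom C f)" "f \<cdot> g = Ident C (Cod C f)"
  using assms by (auto simp: is_iso_def Hom_def)

lemma iso_comp:
  assumes "is_iso C f" "is_iso C g" "Cod C f = Dom C g"
  shows "is_iso C (g \<cdot> f)"
proof -
  obtain f' where f: "f \<in> Arr C" "f' \<in> Arr C" "Dom C f' = Cod C f" "Cod C f' = Dom C f"
    "f' \<cdot> f = Ident C (Dom C f)" "f \<cdot> f' = Ident C (Cod C f)"
    by (rule isoE[OF assms(1)])
  obtain g' where g: "g \<in> Arr C" "g' \<in> Arr C" "Dom C g' = Cod C g" "Cod C g' = Dom C g"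
    "g' \<cdot> g = Ident C (Dom C g)" "g \<cdot> g' = Ident C (Cod C g)"
    by (rule isoE[OF assms(2)])
  have "f' \<cdot> (g' \<cdot> (g \<cdot> f)) = f' \<cdot> ((g' \<cdot> g) \<cdot> f)" "g \<cdot> (f \<cdot> (f' \<cdot> g')) = g \<cdot> ((f \<cdot> f') \<cdot> g')"
    using f(1-4) g(1-4) assms(3) by simp_all
  then show ?thesis
    using f g assms(3) by (intro isoI[where g = "f' \<cdot> g'"]) simp_all
qed

lemma iso_cancel_left:
  assumes "is_iso C f" "g \<in> Arr C" "h \<in> Arr C" "Cod C g = Dom C f" "Cod C h = Dom C f"
    "f \<cdot> g = f \<cdot> h"
  shows "g = h"
proof -
  obtain f' where f: "f \<in> Arr C" "f' \<in> Arr C" "Dom C f' = Cod C f" "Cod C f' = Dom C f"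
    "f' \<cdot> f = Ident C (Dom C f)"
    by (rule isoE[OF assms(1)])
  have "(f' \<cdot> f) \<cdot> g = (f' \<cdot> f) \<cdot> h"
    using assms f(1-4) by simp
  then show ?thesis
    using f assms by simp
qed

end

locale functor_between =
  C: category C + D: category D for C :: "('o, 'm) cat" and D :: "('p, 'n) cat" +
  fixes T :: "('o, 'm, 'p, 'n) func"
  assumes functor_T: "is_functor C D T"
begin

lemma FO_Obj [simp]: "a \<in> Obj C \<Longrightarrow> FO T a \<in> Obj D"
  and FM_Ident [simp]: "a \<in> Obj C \<Longrightarrow> FM T (Ident C a) = Ident D (FO T a)"
  and FM_Arr [simp]: "f \<in> Arr C \<Longrightarrow> FM T f \<in> Arr D"
  and Dom_FM [simp]: "f \<in> Arr C \<Longrightarrow> Dom D (FM T f) = FO T (Dom C f)"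
  and Cod_FM [simp]: "f \<in> Arr C \<Longrightarrow> Cod D (FM T f) = FO T (Cod C f)"
  and FM_Comp [simp]: "\<lbrakk>f \<in> Arr C; g \<in> Arr C; Cod C f = Dom C g\<rbrakk>
        \<Longrightarrow> FM T (g \<cdot>\<^bsub>C\<^esub> f) = FM T g \<cdot>\<^bsub>D\<^esub> FM T f"
  using functor_T by (auto simp: is_functor_def Hom_def)

lemma FM_iso:
  assumes "is_iso C f"
  shows "is_iso D (FM T f)"
proof -
  obtain g where g: "f \<in> Arr C" "g \<in> Arr C" "Dom C g = Cod C f" "Cod C g = Dom C f"
    "g \<cdot>\<^bsub>C\<^esub> f = Ident C (Dom C f)" "f \<cdot>\<^bsub>C\<^esub> g = Ident C (Cod C f)"
    by (rule C.isoE[OF assms])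
  have "FM T (g \<cdot>\<^bsub>C\<^esub> f) = Ident D (FO T (Dom C f))" "FM T (f \<cdot>\<^bsub>C\<^esub> g) = Ident D (FO T (Cod C f))"
    by (simp_all add: g)
  then show ?thesis
    using g(1-4) by (intro D.isoI[where g = "FM T g"]) simp_all
qed

end

lemma functor_betweenI: "is_functor C D T \<Longrightarrow> functor_between C D T"
  by (auto simp: is_functor_def functor_between_def functor_between_axioms_def)

lemma is_functor_comp:
  assumes "is_functor C D T" "is_functor D B S"
  shows "is_functor C B (comp_func S T)"
proof -
  interpret T: functor_between C D T by (rule functor_betweenI[OF assms(1)])
  interpret S: functor_between D B S by (rule functor_betweenI[OF assms(2)])
  show ?thesis
    unfolding is_functor_def
    by (auto simp: comp_func_def Hom_def T.C.category_axioms S.D.category_axioms)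
qed

lemma pullbackD:
  assumes "is_pullback C f g p q"
  shows "f \<in> Arr C" "g \<in> Arr C" "p \<in> Arr C" "q \<in> Arr C" "Cod C f = Cod C g" "Dom C p = Dom C q"
    "Cod C p = Dom C f" "Cod C q = Dom C g" "f \<cdot>\<^bsub>C\<^esub> p = g \<cdot>\<^bsub>C\<^esub> q"
  using assms by (auto simp: is_pullback_def)

lemma pullback_ex1:
  assumes "is_pullback C f g p q" "s \<in> Arr C" "t \<in> Arr C" "Dom C s = Dom C t"
    "Cod C s = Dom C f" "Cod C t = Dom C g" "f \<cdot>\<^bsub>C\<^esub> s = g \<cdot>\<^bsub>C\<^esub> t"
  shows "\<exists>!u. u \<in> Hom C (Dom C s) (Dom C p) \<and> p \<cdot>\<^bsub>C\<^esub> u = s \<and> q \<cdot>\<^bsub>C\<^esub> u = t"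
  using assms unfolding is_pullback_def by blast

lemma pullback_lift:
  assumes "is_pullback C f g p q" "s \<in> Arr C" "t \<in> Arr C" "Dom C s = Dom C t"
    "Cod C s = Dom C f" "Cod C t = Dom C g" "f \<cdot>\<^bsub>C\<^esub> s = g \<cdot>\<^bsub>C\<^esub> t"
  obtains u where "u \<in> Arr C" "Dom C u = Dom C s" "Cod C u = Dom C p"
    "p \<cdot>\<^bsub>C\<^esub> u = s" "q \<cdot>\<^bsub>C\<^esub> u = t"
  using pullback_ex1[OF assms] by (auto simp: Hom_def)

context category
begin

lemma pullback_eqI:
  assumes pb: "is_pullback C f g p q" and "u \<in> Arr C" "v \<in> Arr C" "Dom C u = Dom C v"
    "Cod C u = Dom C p" "Cod C v = Dom C p" "p \<cdot> u = p \<cdot> v" "q \<cdot> u = q \<cdot> v"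
  shows "u = v"
proof -
  note p = pullbackD[OF pb]
  have "f \<cdot> (p \<cdot> u) = g \<cdot> (q \<cdot> u)"
    using assms p by (simp flip: assoc)
  then have "\<exists>!w. w \<in> Hom C (Dom C (p \<cdot> u)) (Dom C p) \<and> p \<cdot> w = p \<cdot> u \<and> q \<cdot> w = q \<cdot> u"
    using assms p by (intro pullback_ex1[OF pb]) simp_all
  then show ?thesis
    using assms p by (auto simp: Hom_def)
qed

text \<open>The induced arrows in the two directions are mutually inverse, since each composite agrees with
  the identity after both projections.\<close>

lemma pullback_comparison_iso:
  assumes "is_pullback C f g p q" "is_pullback C f g p' q'"
  obtains i where "is_iso C i" "Dom C i = Dom C p'" "Cod C i = Dom C p" "p \<cdot> i = p'" "q \<cdot> i = q'"
proof -
  note pq = pullbackD[OF assms(1)] and pq' = pullbackD[OF assms(2)]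
  obtain i where i: "i \<in> Arr C" "Dom C i = Dom C p'" "Cod C i = Dom C p" "p \<cdot> i = p'" "q \<cdot> i = q'"
    using pq' by (elim pullback_lift[OF assms(1), of p' q']) simp_all
  obtain j where j: "j \<in> Arr C" "Dom C j = Dom C p" "Cod C j = Dom C p'" "p' \<cdot> j = p" "q' \<cdot> j = q"
    using pq by (elim pullback_lift[OF assms(2), of p q]) simp_all
  have "p \<cdot> (i \<cdot> j) = (p \<cdot> i) \<cdot> j" "q \<cdot> (i \<cdot> j) = (q \<cdot> i) \<cdot> j"
    "p' \<cdot> (j \<cdot> i) = (p' \<cdot> j) \<cdot> i" "q' \<cdot> (j \<cdot> i) = (q' \<cdot> j) \<cdot> i"
    using i(1-3) j(1-3) pq(1-8) pq'(1-8) by simp_all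
  then have pij: "p \<cdot> (i \<cdot> j) = p" "q \<cdot> (i \<cdot> j) = q" "p' \<cdot> (j \<cdot> i) = p'" "q' \<cdot> (j \<cdot> i) = q'"
    using i(4-5) j(4-5) by simp_all
  have "i \<cdot> j = Ident C (Dom C p)"
    using i(1-3) j(1-3) pq(1-8) pij by - (rule pullback_eqI[OF assms(1)]; simp)
  moreover have "j \<cdot> i = Ident C (Dom C p')"
    using i(1-3) j(1-3) pq'(1-8) pij by - (rule pullback_eqI[OF assms(2)]; simp)
  ultimately have "is_iso C i"
    using i j by (intro isoI[where g = j]) simp_all
  then show thesis
    using i that by blast
qed

end

lemma is_coneD:
  assumes "is_cone J C T x \<pi>"
  shows "x \<in> Obj C"
    and "j \<in> Obj J \<Longrightarrow> \<pi> j \<in> Arr C" "j \<in> Obj J \<Longrightarrow> Dom C (\<pi> j) = x" "j \<in> Obj J \<Longrightarrow> Cod C (\<pi> j) = FO T j"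
    and "k \<in> Arr J \<Longrightarrow> FM T k \<cdot>\<^bsub>C\<^esub> \<pi> (Dom J k) = \<pi> (Cod J k)"
  using assms by (auto simp: is_cone_def Hom_def)

lemma is_coneI:
  assumes "x \<in> Obj C"
    and "\<And>j. j \<in> Obj J \<Longrightarrow> \<pi> j \<in> Arr C \<and> Dom C (\<pi> j) = x \<and> Cod C (\<pi> j) = FO T j"
    and "\<And>k. k \<in> Arr J \<Longrightarrow> FM T k \<cdot>\<^bsub>C\<^esub> \<pi> (Dom J k) = \<pi> (Cod J k)"
  shows "is_cone J C T x \<pi>"
  using assms by (auto simp: is_cone_def Hom_def)

section \<open>Cartesian arrows of a left adjoint\<close>

lemma cartesian_arrow_ex1:
  assumes "cartesian_arrow D C P v" "g \<in> Arr D" "Cod D g = Cod D v" "h \<in> Arr C"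
    "Dom C h = FO P (Dom D g)" "Cod C h = FO P (Dom D v)" "FM P v \<cdot>\<^bsub>C\<^esub> h = FM P g"
  shows "\<exists>!h'. h' \<in> Hom D (Dom D g) (Dom D v) \<and> FM P h' = h \<and> v \<cdot>\<^bsub>D\<^esub> h' = g"
proof -
  have "h \<in> Hom C (FO P (Dom D g)) (FO P (Dom D v))"
    using assms by (simp add: Hom_def)
  with assms show ?thesis
    unfolding cartesian_arrow_def by blast
qed

lemma cartesian_arrow_lift:
  assumes "cartesian_arrow D C P v" "g \<in> Arr D" "Cod D g = Cod D v" "h \<in> Arr C"
    "Dom C h = FO P (Dom D g)" "Cod C h = FO P (Dom D v)" "FM P v \<cdot>\<^bsub>C\<^esub> h = FM P g"
  obtains h' where "h' \<in> Arr D" "Dom D h' = Dom D g" "Cod D h' = Dom D v" "FM P h' = h" "v \<cdot>\<^bsub>D\<^esub> h' = g"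
  using cartesian_arrow_ex1[OF assms] by (auto simp: Hom_def)

lemma cartesian_arrow_eqI:
  assumes "cartesian_arrow D C P v" "functor_between D C P" "a \<in> Arr D" "b \<in> Arr D"
    "Dom D a = Dom D b" "Cod D a = Dom D v" "Cod D b = Dom D v"
    "FM P a = FM P b" "v \<cdot>\<^bsub>D\<^esub> a = v \<cdot>\<^bsub>D\<^esub> b"
  shows "a = b"
proof -
  interpret P: functor_between D C P by fact
  have v: "v \<in> Arr D"
    using assms(1) by (simp add: cartesian_arrow_def)
  have "\<exists>!c. c \<in> Hom D (Dom D (v \<cdot>\<^bsub>D\<^esub> a)) (Dom D v) \<and> FM P c = FM P a \<and> v \<cdot>\<^bsub>D\<^esub> c = v \<cdot>\<^bsub>D\<^esub> a"
    using assms(3,6) v by (intro cartesian_arrow_ex1[OF assms(1)]) simp_all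
  then show ?thesis
    using assms v by (auto simp: Hom_def)
qed

locale left_adjoint =
  L: functor_between F E L + R: functor_between E F R
  for F :: "('p, 'n) cat" and E :: "('o, 'm) cat" and L R +
  fixes \<eta> :: "'p \<Rightarrow> 'n" and \<epsilon> :: "'o \<Rightarrow> 'm"
  assumes adjunction: "adjunction F E L R \<eta> \<epsilon>"
begin

lemma unit_Arr [simp]: "x \<in> Obj F \<Longrightarrow> \<eta> x \<in> Arr F"
  and Dom_unit [simp]: "x \<in> Obj F \<Longrightarrow> Dom F (\<eta> x) = x"
  and Cod_unit [simp]: "x \<in> Obj F \<Longrightarrow> Cod F (\<eta> x) = FO R (FO L x)"
  and unit_natural: "g \<in> Arr F \<Longrightarrow> FM R (FM L g) \<cdot>\<^bsub>F\<^esub> \<eta> (Dom F g) = \<eta> (Cod F g) \<cdot>\<^bsub>F\<^esub> g"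
  and counit_Arr [simp]: "e \<in> Obj E \<Longrightarrow> \<epsilon> e \<in> Arr E"
  and Dom_counit [simp]: "e \<in> Obj E \<Longrightarrow> Dom E (\<epsilon> e) = FO L (FO R e)"
  and Cod_counit [simp]: "e \<in> Obj E \<Longrightarrow> Cod E (\<epsilon> e) = e"
  and counit_natural: "h \<in> Arr E \<Longrightarrow> \<epsilon> (Cod E h) \<cdot>\<^bsub>E\<^esub> FM L (FM R h) = h \<cdot>\<^bsub>E\<^esub> \<epsilon> (Dom E h)"
  and triangle_L: "x \<in> Obj F \<Longrightarrow> \<epsilon> (FO L x) \<cdot>\<^bsub>E\<^esub> FM L (\<eta> x) = Ident E (FO L x)"
  and triangle_R: "e \<in> Obj E \<Longrightarrow> FM R (\<epsilon> e) \<cdot>\<^bsub>F\<^esub> \<eta> (FO R e) = Ident F (FO R e)"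
  using adjunction
  by (auto simp: adjunction_def nat_trans_def id_func_def comp_func_def Hom_def)

text \<open>\<open>flat\<close> and \<open>sharp\<close> are the two directions of the bijection between arrows \<open>x \<rightarrow> R e\<close> and
  \<open>L x \<rightarrow> e\<close>.\<close>

definition flat :: "'o \<Rightarrow> 'n \<Rightarrow> 'm" where
  "flat e g = \<epsilon> e \<cdot>\<^bsub>E\<^esub> FM L g"

definition sharp :: "'p \<Rightarrow> 'm \<Rightarrow> 'n" where
  "sharp x k = FM R k \<cdot>\<^bsub>F\<^esub> \<eta> x"

lemma flat_Arr [simp]: "\<lbrakk>g \<in> Arr F; e \<in> Obj E; Cod F g = FO R e\<rbrakk> \<Longrightarrow> flat e g \<in> Arr E"
  and Dom_flat [simp]: "\<lbrakk>g \<in> Arr F; e \<in> Obj E; Cod F g = FO R e\<rbrakk> \<Longrightarrow> Dom E (flat e g) = FO L (Dom F g)"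
  and Cod_flat [simp]: "\<lbrakk>g \<in> Arr F; e \<in> Obj E; Cod F g = FO R e\<rbrakk> \<Longrightarrow> Cod E (flat e g) = e"
  by (simp_all add: flat_def)

lemma sharp_Arr [simp]: "\<lbrakk>x \<in> Obj F; k \<in> Arr E; Dom E k = FO L x\<rbrakk> \<Longrightarrow> sharp x k \<in> Arr F"
  and Dom_sharp [simp]: "\<lbrakk>x \<in> Obj F; k \<in> Arr E; Dom E k = FO L x\<rbrakk> \<Longrightarrow> Dom F (sharp x k) = x"
  and Cod_sharp [simp]:
    "\<lbrakk>x \<in> Obj F; k \<in> Arr E; Dom E k = FO L x\<rbrakk> \<Longrightarrow> Cod F (sharp x k) = FO R (Cod E k)"
  by (simp_all add: sharp_def)

lemma flat_Comp:
  "\<lbrakk>g \<in> Arr F; m \<in> Arr F; e \<in> Obj E; Cod F g = FO R e; Cod F m = Dom F g\<rbrakk>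
     \<Longrightarrow> flat e (g \<cdot>\<^bsub>F\<^esub> m) = flat e g \<cdot>\<^bsub>E\<^esub> FM L m"
  by (simp add: flat_def)

lemma flat_FM_Comp:
  assumes "g \<in> Arr F" "h \<in> Arr E" "Cod F g = FO R (Dom E h)" "e = Cod E h"
  shows "flat e (FM R h \<cdot>\<^bsub>F\<^esub> g) = h \<cdot>\<^bsub>E\<^esub> flat (Dom E h) g"
proof -
  have "flat (Cod E h) (FM R h \<cdot>\<^bsub>F\<^esub> g) = (\<epsilon> (Cod E h) \<cdot>\<^bsub>E\<^esub> FM L (FM R h)) \<cdot>\<^bsub>E\<^esub> FM L g"
    using assms by (simp add: flat_def)
  also have "\<dots> = h \<cdot>\<^bsub>E\<^esub> flat (Dom E h) g"
    using assms by (simp add: counit_natural flat_def)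
  finally show ?thesis
    using assms by simp
qed

lemma flat_unit: "d \<in> Obj F \<Longrightarrow> flat (FO L d) (\<eta> d) = Ident E (FO L d)"
  by (simp add: flat_def triangle_L)

lemma flat_sharp:
  assumes "x \<in> Obj F" "k \<in> Arr E" "Dom E k = FO L x" "e = Cod E k"
  shows "flat e (sharp x k) = k"
  using assms by (simp add: sharp_def flat_FM_Comp flat_unit)

lemma sharp_flat:
  assumes "g \<in> Arr F" "e \<in> Obj E" "Cod F g = FO R e"
  shows "sharp (Dom F g) (flat e g) = g"
proof -
  have "sharp (Dom F g) (flat e g) = FM R (\<epsilon> e) \<cdot>\<^bsub>F\<^esub> (FM R (FM L g) \<cdot>\<^bsub>F\<^esub> \<eta> (Dom F g))"
    using assms by (simp add: flat_def sharp_def)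
  also have "\<dots> = (FM R (\<epsilon> e) \<cdot>\<^bsub>F\<^esub> \<eta> (FO R e)) \<cdot>\<^bsub>F\<^esub> g"
    using assms by (simp add: unit_natural)
  finally show ?thesis
    using assms by (simp add: triangle_R)
qed

lemma flat_inject:
  assumes "g \<in> Arr F" "g' \<in> Arr F" "e \<in> Obj E" "Cod F g = FO R e" "Cod F g' = FO R e"
    "Dom F g = Dom F g'" "flat e g = flat e g'"
  shows "g = g'"
  using sharp_flat[of g e] sharp_flat[of g' e] assms by metis

text \<open>An arrow \<open>y \<rightarrow> Dom v\<close> is a pair of \<open>g : y \<rightarrow> d\<close> and \<open>s : y \<rightarrow> R (Dom u)\<close> that agree in \<open>R (L d)\<close>.
  Transposed, the pair consists of \<open>g\<close> and an arrow \<open>L y \<rightarrow> Dom u\<close> through which \<open>L g\<close> factors along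
  \<open>u\<close>. If the transpose of \<open>q\<close> identifies \<open>L (Dom v)\<close> with \<open>Dom u\<close>, this is the universal property
  of a cartesian arrow over \<open>u\<close>.\<close>

lemma pullback_along_unit_cartesian:
  assumes u: "u \<in> Arr E" "Cod E u = FO L d" and d: "d \<in> Obj F"
    and pb: "is_pullback F (\<eta> d) (FM R u) v q"
    and iso: "is_iso E (flat (Dom E u) q)"
  shows "cartesian_arrow F E L v" and "FM L v = u \<cdot>\<^bsub>E\<^esub> flat (Dom E u) q"
proof -
  let ?\<sigma> = "flat (Dom E u) q"
  note vq = pullbackD[OF pb]
  have v: "v \<in> Arr F" "Cod F v = d" and q: "q \<in> Arr F" "Cod F q = FO R (Dom E u)" "Dom F q = Dom F v"
    using vq u d by simp_all
  have "FM L v = flat (FO L d) (\<eta> d) \<cdot>\<^bsub>E\<^esub> FM L v"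
    using v d by (simp add: flat_unit)
  also have "\<dots> = flat (FO L d) (\<eta> d \<cdot>\<^bsub>F\<^esub> v)"
    using v d by (simp add: flat_Comp)
  also have "\<dots> = u \<cdot>\<^bsub>E\<^esub> ?\<sigma>"
    using vq u q by (simp add: flat_FM_Comp)
  finally show Lv: "FM L v = u \<cdot>\<^bsub>E\<^esub> ?\<sigma>" .
  show "cartesian_arrow F E L v"
    unfolding cartesian_arrow_def
  proof (rule conjI[OF v(1)], intro allI impI, elim conjE)
    fix g k
    assume g: "g \<in> Arr F" "Cod F g = Cod F v"
      and "k \<in> Hom E (FO L (Dom F g)) (FO L (Dom F v))" and Lvk: "FM L v \<cdot>\<^bsub>E\<^esub> k = FM L g"
    then have k: "k \<in> Arr E" "Dom E k = FO L (Dom F g)" "Cod E k = FO L (Dom F v)"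
      by (simp_all add: Hom_def)
    \<comment> \<open>the transpose of \<open>q h\<close> is \<open>\<sigma> (L h)\<close>, so \<open>L h = k\<close> dictates the second component of \<open>h\<close>\<close>
    let ?s = "sharp (Dom F g) (?\<sigma> \<cdot>\<^bsub>E\<^esub> k)"
    have s: "?s \<in> Arr F" "Dom F ?s = Dom F g" "Cod F ?s = FO R (Dom E u)"
      using g k q u by simp_all
    have "flat (FO L d) (\<eta> d \<cdot>\<^bsub>F\<^esub> g) = FM L g"
      using g v d by (simp add: flat_Comp flat_unit)
    also have "\<dots> = u \<cdot>\<^bsub>E\<^esub> (?\<sigma> \<cdot>\<^bsub>E\<^esub> k)"
      using u k q by (simp add: Lv flip: Lvk)
    also have "\<dots> = flat (FO L d) (FM R u \<cdot>\<^bsub>F\<^esub> ?s)"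
      using u k q g s by (simp add: flat_FM_Comp flat_sharp)
    finally have "flat (FO L d) (\<eta> d \<cdot>\<^bsub>F\<^esub> g) = flat (FO L d) (FM R u \<cdot>\<^bsub>F\<^esub> ?s)" .
    then have "\<eta> d \<cdot>\<^bsub>F\<^esub> g = FM R u \<cdot>\<^bsub>F\<^esub> ?s"
      using g v s u d by - (rule flat_inject[of _ _ "FO L d"]; simp)
    then obtain h where h: "h \<in> Arr F" "Dom F h = Dom F g" "Cod F h = Dom F v"
      "v \<cdot>\<^bsub>F\<^esub> h = g" "q \<cdot>\<^bsub>F\<^esub> h = ?s"
      using g v s u d by (elim pullback_lift[OF pb, rotated 5]) simp_all
    have \<sigma>_L: "?\<sigma> \<cdot>\<^bsub>E\<^esub> FM L h' = flat (Dom E u) (q \<cdot>\<^bsub>F\<^esub> h')"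
      if "h' \<in> Arr F" "Cod F h' = Dom F v" for h'
      using that q u by (simp add: flat_Comp)
    have "?\<sigma> \<cdot>\<^bsub>E\<^esub> FM L h = ?\<sigma> \<cdot>\<^bsub>E\<^esub> k"
      using h k g q u by (simp add: \<sigma>_L flat_sharp)
    then have Lh: "FM L h = k"
      using h k q u by - (rule L.D.iso_cancel_left[OF iso]; simp)
    show "\<exists>!h'. h' \<in> Hom F (Dom F g) (Dom F v) \<and> FM L h' = k \<and> v \<cdot>\<^bsub>F\<^esub> h' = g"
    proof (rule ex1I[of _ h])
      show "h \<in> Hom F (Dom F g) (Dom F v) \<and> FM L h = k \<and> v \<cdot>\<^bsub>F\<^esub> h = g"
        using h Lh by (simp add: Hom_def)
    next
      fix h'
      assume "h' \<in> Hom F (Dom F g) (Dom F v) \<and> FM L h' = k \<and> v \<cdot>\<^bsub>F\<^esub> h' = g"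
      then have h': "h' \<in> Arr F" "Dom F h' = Dom F g" "Cod F h' = Dom F v" "FM L h' = k" "v \<cdot>\<^bsub>F\<^esub> h' = g"
        by (simp_all add: Hom_def)
      have "flat (Dom E u) (q \<cdot>\<^bsub>F\<^esub> h') = flat (Dom E u) (q \<cdot>\<^bsub>F\<^esub> h)"
        using h' h Lh \<sigma>_L[of h] \<sigma>_L[of h'] by simp
      then have "q \<cdot>\<^bsub>F\<^esub> h' = q \<cdot>\<^bsub>F\<^esub> h"
        using h(1-3) h'(1-3) q u by - (rule flat_inject[of _ _ "Dom E u"]; simp)
      then show "h' = h"
        using h h' q u by - (rule L.C.pullback_eqI[OF pb]; simp)
    qed
  qed
qed

text \<open>A cone over \<open>\<alpha>\<close> and \<open>R h\<close> with vertex \<open>y\<close> transposes to a cone over the transpose of \<open>\<alpha>\<close> and \<open>h\<close>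
  with vertex \<open>L y\<close>, whose leg to \<open>L (Dom \<alpha>)\<close> is the image of an arrow \<open>s : y \<rightarrow> Dom \<alpha>\<close>. The
  pullback in \<open>E\<close> factors this image through \<open>u\<close>, hence through \<open>L v\<close>, and cartesianness of \<open>v\<close>
  lifts the factorisation to \<open>F\<close>.\<close>

lemma cartesian_lift_pullback:
  assumes h: "h \<in> Arr E" and \<alpha>: "\<alpha> \<in> Arr F" "Cod F \<alpha> = FO R (Cod E h)"
    and pb: "is_pullback E (flat (Cod E h) \<alpha>) h u w"
    and cart: "cartesian_arrow F E L v" and v: "Cod F v = Dom F \<alpha>" "FM L v = u \<cdot>\<^bsub>E\<^esub> \<sigma>"
    and \<sigma>: "is_iso E \<sigma>" "Dom E \<sigma> = FO L (Dom F v)" "Cod E \<sigma> = Dom E u"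
  shows "is_pullback F \<alpha> (FM R h) v (sharp (Dom F v) (w \<cdot>\<^bsub>E\<^esub> \<sigma>))"
proof -
  let ?q = "sharp (Dom F v) (w \<cdot>\<^bsub>E\<^esub> \<sigma>)"
  note uw = pullbackD[OF pb]
  have v': "v \<in> Arr F"
    using cart by (simp add: cartesian_arrow_def)
  obtain \<tau> where \<sigma>': "\<sigma> \<in> Arr E" "\<tau> \<in> Arr E" "Dom E \<tau> = Cod E \<sigma>" "Cod E \<tau> = Dom E \<sigma>"
    "\<sigma> \<cdot>\<^bsub>E\<^esub> \<tau> = Ident E (Cod E \<sigma>)"
    by (rule L.D.isoE[OF \<sigma>(1)])
  have u: "u \<in> Arr E" "Cod E u = FO L (Dom F \<alpha>)" and w: "w \<in> Arr E" "Dom E w = Dom E u" "Cod E w = Dom E h"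
    using uw \<alpha> h by simp_all
  have q: "?q \<in> Arr F" "Dom F ?q = Dom F v" "Cod F ?q = FO R (Dom E h)"
    and flat_q: "flat (Dom E h) ?q = w \<cdot>\<^bsub>E\<^esub> \<sigma>"
    using v' w \<sigma> \<sigma>' by (simp_all add: flat_sharp)
  have "flat (Cod E h) (\<alpha> \<cdot>\<^bsub>F\<^esub> v) = (flat (Cod E h) \<alpha> \<cdot>\<^bsub>E\<^esub> u) \<cdot>\<^bsub>E\<^esub> \<sigma>"
    using \<alpha> h v v' u \<sigma> \<sigma>' by (simp add: flat_Comp)
  also have "\<dots> = flat (Cod E h) (FM R h \<cdot>\<^bsub>F\<^esub> ?q)"
    using h q flat_q uw(9) w \<sigma> \<sigma>' by (simp add: flat_FM_Comp)
  finally have comm: "\<alpha> \<cdot>\<^bsub>F\<^esub> v = FM R h \<cdot>\<^bsub>F\<^esub> ?q"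
    using \<alpha> h v v' q by - (rule flat_inject[of _ _ "Cod E h"]; simp)
  show ?thesis
    unfolding is_pullback_def
  proof (intro conjI ballI impI, goal_cases)
    case (10 s t)
    then have s: "s \<in> Arr F" "Cod F s = Dom F \<alpha>" and t: "t \<in> Arr F" "Dom F t = Dom F s" "Cod F t = FO R (Dom E h)"
      and st: "\<alpha> \<cdot>\<^bsub>F\<^esub> s = FM R h \<cdot>\<^bsub>F\<^esub> t"
      using h by simp_all
    have "flat (Cod E h) \<alpha> \<cdot>\<^bsub>E\<^esub> FM L s = flat (Cod E h) (\<alpha> \<cdot>\<^bsub>F\<^esub> s)"
      using \<alpha> h s by (simp add: flat_Comp)
    also have "\<dots> = h \<cdot>\<^bsub>E\<^esub> flat (Dom E h) t"
      using h s t by (simp add: st flat_FM_Comp)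
    finally obtain k where k: "k \<in> Arr E" "Dom E k = FO L (Dom F s)" "Cod E k = Dom E u"
      "u \<cdot>\<^bsub>E\<^esub> k = FM L s" "w \<cdot>\<^bsub>E\<^esub> k = flat (Dom E h) t"
      using \<alpha> h s t by (elim pullback_lift[OF pb, rotated 5]) simp_all
    have \<sigma>\<tau>k: "\<sigma> \<cdot>\<^bsub>E\<^esub> (\<tau> \<cdot>\<^bsub>E\<^esub> k) = k"
    proof -
      have "\<sigma> \<cdot>\<^bsub>E\<^esub> (\<tau> \<cdot>\<^bsub>E\<^esub> k) = (\<sigma> \<cdot>\<^bsub>E\<^esub> \<tau>) \<cdot>\<^bsub>E\<^esub> k"
        using k(1-3) \<sigma> \<sigma>'(1-4) by simp
      then show ?thesis
        using k(1-3) \<sigma> \<sigma>' by simp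
    qed
    have "FM L v \<cdot>\<^bsub>E\<^esub> (\<tau> \<cdot>\<^bsub>E\<^esub> k) = FM L s"
      using k u \<sigma> \<sigma>' \<sigma>\<tau>k by (simp add: v)
    then obtain j where j: "j \<in> Arr F" "Dom F j = Dom F s" "Cod F j = Dom F v"
      "FM L j = \<tau> \<cdot>\<^bsub>E\<^esub> k" "v \<cdot>\<^bsub>F\<^esub> j = s"
      using k \<sigma> \<sigma>' s v by (elim cartesian_arrow_lift[OF cart, rotated 5]) simp_all
    have flat_q_Comp: "flat (Dom E h) (?q \<cdot>\<^bsub>F\<^esub> i) = w \<cdot>\<^bsub>E\<^esub> (\<sigma> \<cdot>\<^bsub>E\<^esub> FM L i)"
      if "i \<in> Arr F" "Cod F i = Dom F v" for i
      using that h q w \<sigma> \<sigma>' by (simp add: flat_Comp flat_q)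
    have "flat (Dom E h) (?q \<cdot>\<^bsub>F\<^esub> j) = flat (Dom E h) t"
      using j \<sigma>\<tau>k k by (simp add: flat_q_Comp)
    then have qj: "?q \<cdot>\<^bsub>F\<^esub> j = t"
      using j t q h by - (rule flat_inject[of _ _ "Dom E h"]; simp)
    show ?case
    proof (rule ex1I[of _ j])
      show "j \<in> Hom F (Dom F s) (Dom F v) \<and> v \<cdot>\<^bsub>F\<^esub> j = s \<and> ?q \<cdot>\<^bsub>F\<^esub> j = t"
        using j qj by (simp add: Hom_def)
    next
      fix i
      assume "i \<in> Hom F (Dom F s) (Dom F v) \<and> v \<cdot>\<^bsub>F\<^esub> i = s \<and> ?q \<cdot>\<^bsub>F\<^esub> i = t"
      then have i: "i \<in> Arr F" "Dom F i = Dom F s" "Cod F i = Dom F v" "v \<cdot>\<^bsub>F\<^esub> i = s" "?q \<cdot>\<^bsub>F\<^esub> i = t"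
        by (simp_all add: Hom_def)
      have "u \<cdot>\<^bsub>E\<^esub> (\<sigma> \<cdot>\<^bsub>E\<^esub> FM L i) = FM L v \<cdot>\<^bsub>E\<^esub> FM L i"
        using u \<sigma> \<sigma>' i(1-3) by (simp add: v)
      also have "\<dots> = FM L s"
        using i v' by (simp flip: L.FM_Comp)
      finally have "\<sigma> \<cdot>\<^bsub>E\<^esub> FM L i = k"
        using u w \<sigma> \<sigma>' i k flat_q_Comp[of i] by - (rule L.D.pullback_eqI[OF pb]; simp)
      then have "\<sigma> \<cdot>\<^bsub>E\<^esub> FM L i = \<sigma> \<cdot>\<^bsub>E\<^esub> FM L j"
        using \<sigma>\<tau>k j by simp
      then have "FM L i = FM L j"
        using i(1-3) j(1-3) \<sigma> \<sigma>' by - (rule L.D.iso_cancel_left[OF \<sigma>(1)]; simp)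
      then show "i = j"
        using i j by - (rule cartesian_arrow_eqI[OF cart L.functor_between_axioms]; simp)
    qed
  qed (use h \<alpha> v v' q comm in simp_all)
qed

end

section \<open>Slice categories and pullback functors\<close>

lemma slice_simps [simp]:
  "Obj (slice C x) = {a \<in> Arr C. Cod C a = x}"
  "(a, m, b) \<in> Arr (slice C x) \<longleftrightarrow> a \<in> Arr C \<and> Cod C a = x \<and> b \<in> Arr C \<and> Cod C b = x \<and>
     m \<in> Arr C \<and> Dom C m = Dom C a \<and> Cod C m = Dom C b \<and> b \<cdot>\<^bsub>C\<^esub> m = a"
  "Dom (slice C x) (a, m, b) = a"
  "Cod (slice C x) (a, m, b) = b"
  "Ident (slice C x) a = (a, Ident C (Dom C a), a)"
  "(b', n, c) \<cdot>\<^bsub>slice C x\<^esub> (a, m, b) = (a, n \<cdot>\<^bsub>C\<^esub> m, c)"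
  by (auto simp: slice_def Hom_def)

lemma Arr_slice_triple:
  assumes "t \<in> Arr (slice C x)"
  obtains a m b where "t = (a, m, b)" "a \<in> Arr C" "Cod C a = x" "b \<in> Arr C" "Cod C b = x"
    "m \<in> Arr C" "Dom C m = Dom C a" "Cod C m = Dom C b" "b \<cdot>\<^bsub>C\<^esub> m = a"
  using assms by (cases t) auto

context category
begin

lemma category_slice: "category (slice C x)"
proof
  fix t a b assume "t \<in> Hom (slice C x) a b"
  fix s c assume "s \<in> Hom (slice C x) b c"
  with \<open>t \<in> Hom (slice C x) a b\<close> obtain m n where
    t: "t = (a, m, b)" "(a, m, b) \<in> Arr (slice C x)" and s: "s = (b, n, c)" "(b, n, c) \<in> Arr (slice C x)"
    unfolding Hom_def by (cases s; cases t) auto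
  then have "c \<cdot> (n \<cdot> m) = (c \<cdot> n) \<cdot> m"
    by (intro assoc[symmetric]) simp_all
  with t s show "s \<cdot>\<^bsub>slice C x\<^esub> t \<in> Hom (slice C x) a c"
    by (simp add: Hom_def)
  fix r d assume "r \<in> Hom (slice C x) c d"
  then obtain k where r: "r = (c, k, d)" "(c, k, d) \<in> Arr (slice C x)"
    unfolding Hom_def by (cases r) auto
  with t s show "(r \<cdot>\<^bsub>slice C x\<^esub> s) \<cdot>\<^bsub>slice C x\<^esub> t = r \<cdot>\<^bsub>slice C x\<^esub> (s \<cdot>\<^bsub>slice C x\<^esub> t)"
    by simp
qed (auto simp: Hom_def elim!: Arr_slice_triple)

lemma iso_slice_iff:
  assumes "(a, m, b) \<in> Arr (slice C x)"
  shows "is_iso (slice C x) (a, m, b) \<longleftrightarrow> is_iso C m"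
proof
  assume "is_iso (slice C x) (a, m, b)"
  then obtain s where "s \<in> Arr (slice C x)" "Dom (slice C x) s = b" "Cod (slice C x) s = a"
    "s \<cdot>\<^bsub>slice C x\<^esub> (a, m, b) = (a, Ident C (Dom C a), a)"
    "(a, m, b) \<cdot>\<^bsub>slice C x\<^esub> s = (b, Ident C (Dom C b), b)"
    by (auto simp only: is_iso_def Hom_def slice_simps)
  moreover then obtain n where "s = (b, n, a)"
    by (metis Arr_slice_triple slice_simps(3,4))
  ultimately have "n \<in> Arr C" "Dom C n = Dom C b" "Cod C n = Dom C a"
    "n \<cdot> m = Ident C (Dom C a)" "m \<cdot> n = Ident C (Dom C b)"
    by simp_all
  moreover have "m \<in> Arr C" "Dom C m = Dom C a" "Cod C m = Dom C b"
    using assms by simp_all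
  ultimately show "is_iso C m"
    by (intro isoI[where g = n]) simp_all
next
  assume "is_iso C m"
  then obtain n where n: "m \<in> Arr C" "n \<in> Arr C" "Dom C n = Cod C m" "Cod C n = Dom C m"
    "n \<cdot> m = Ident C (Dom C m)" "m \<cdot> n = Ident C (Cod C m)"
    by (rule isoE)
  have "a \<cdot> n = (b \<cdot> m) \<cdot> n"
    using assms by simp
  also have "\<dots> = b \<cdot> (m \<cdot> n)"
    using assms n(1-4) by (intro assoc) simp_all
  also have "\<dots> = b"
    using assms n by simp
  finally show "is_iso (slice C x) (a, m, b)"
    using assms n category.isoI[OF category_slice, of "(a, m, b)" x "(b, n, a)"] by simp
qed

end

locale category_with_pullbacks = category C for C :: "('o, 'm) cat" (structure) +
  assumes pullback_exists: "\<lbrakk>f \<in> Arr C; g \<in> Arr C; Cod C f = Cod C g\<rbrakk> \<Longrightarrow> \<exists>p q. is_pullback C f g p q"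
begin

lemma pb_is_pullback:
  assumes "a \<in> Arr C" "h \<in> Arr C" "Cod C a = Cod C h"
  shows "is_pullback C a h (pb1 C h a) (pb2 C h a)"
proof -
  have "\<exists>t. case t of (p, q) \<Rightarrow> is_pullback C a h p q"
    using pullback_exists[OF assms] by auto
  then have "case pb C h a of (p, q) \<Rightarrow> is_pullback C a h p q"
    unfolding pb_def by (rule someI_ex)
  then show ?thesis
    by (simp add: case_prod_unfold)
qed

lemma pb_simps [simp]:
  assumes "a \<in> Arr C" "h \<in> Arr C" "Cod C a = Cod C h"
  shows "pb1 C h a \<in> Arr C" "pb2 C h a \<in> Arr C" "Dom C (pb1 C h a) = Dom C (pb2 C h a)"
    "Cod C (pb1 C h a) = Dom C a" "Cod C (pb2 C h a) = Dom C h"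
  using pullbackD[OF pb_is_pullback[OF assms]] by simp_all

lemma pb_commutes:
  assumes "a \<in> Arr C" "h \<in> Arr C" "Cod C a = Cod C h"
  shows "a \<cdot> pb1 C h a = h \<cdot> pb2 C h a"
  using pullbackD[OF pb_is_pullback[OF assms]] by simp

text \<open>Gives the arrow denoted by the definite description in \<open>pb_func\<close> together with the equations that
  characterise it; equalities between such arrows then follow by \<open>pb_eqI\<close>.\<close>

lemma pb_func_FM:
  assumes h: "h \<in> Arr C" and t: "(a, m, b) \<in> Arr (slice C (Cod C h))"
  obtains n where "FM (pb_func C h) (a, m, b) = (pb2 C h a, n, pb2 C h b)"
    "n \<in> Arr C" "Dom C n = Dom C (pb2 C h a)" "Cod C n = Dom C (pb2 C h b)"
    "pb1 C h b \<cdot> n = m \<cdot> pb1 C h a" "pb2 C h b \<cdot> n = pb2 C h a"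
proof -
  have "b \<cdot> (m \<cdot> pb1 C h a) = (b \<cdot> m) \<cdot> pb1 C h a"
    using h t by (intro assoc[symmetric]) simp_all
  then have "b \<cdot> (m \<cdot> pb1 C h a) = h \<cdot> pb2 C h a"
    using h t by (simp add: pb_commutes)
  then have "\<exists>!n. n \<in> Hom C (Dom C (m \<cdot> pb1 C h a)) (Dom C (pb1 C h b)) \<and>
      pb1 C h b \<cdot> n = m \<cdot> pb1 C h a \<and> pb2 C h b \<cdot> n = pb2 C h a"
    using h t by (intro pullback_ex1[OF pb_is_pullback]) simp_all
  then have "\<exists>!n. n \<in> Hom C (Dom C (pb2 C h a)) (Dom C (pb2 C h b)) \<and>
      pb1 C h b \<cdot> n = m \<cdot> pb1 C h a \<and> pb2 C h b \<cdot> n = pb2 C h a"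
    using h t by simp
  from theI'[OF this] show thesis
    by (intro that[of "THE n. n \<in> Hom C (Dom C (pb2 C h a)) (Dom C (pb2 C h b)) \<and>
      pb1 C h b \<cdot> n = m \<cdot> pb1 C h a \<and> pb2 C h b \<cdot> n = pb2 C h a"])
      (simp_all add: pb_func_def Hom_def)
qed

lemma pb_eqI:
  assumes "b \<in> Arr C" "h \<in> Arr C" "Cod C b = Cod C h" "u \<in> Arr C" "v \<in> Arr C"
    "Dom C u = Dom C v" "Cod C u = Dom C (pb2 C h b)" "Cod C v = Dom C (pb2 C h b)"
    "pb1 C h b \<cdot> u = pb1 C h b \<cdot> v" "pb2 C h b \<cdot> u = pb2 C h b \<cdot> v"
  shows "u = v"
  using assms by - (rule pullback_eqI[OF pb_is_pullback[OF assms(1-3)]]; simp)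

lemma pb_func_functor:
  assumes h: "h \<in> Arr C"
  shows "is_functor (slice C (Cod C h)) (slice C (Dom C h)) (pb_func C h)"
  unfolding is_functor_def
proof (intro conjI ballI impI category_slice)
  fix a assume "a \<in> Obj (slice C (Cod C h))"
  then have a: "a \<in> Arr C" "Cod C a = Cod C h"
    by simp_all
  then show "FO (pb_func C h) a \<in> Obj (slice C (Dom C h))"
    using h by (simp add: pb_func_def)
  have "(a, Ident C (Dom C a), a) \<in> Arr (slice C (Cod C h))"
    using a by simp
  then obtain n where n: "FM (pb_func C h) (a, Ident C (Dom C a), a) = (pb2 C h a, n, pb2 C h a)"
    "n \<in> Arr C" "Dom C n = Dom C (pb2 C h a)" "Cod C n = Dom C (pb2 C h a)"
    "pb1 C h a \<cdot> n = Ident C (Dom C a) \<cdot> pb1 C h a" "pb2 C h a \<cdot> n = pb2 C h a"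
    by (rule pb_func_FM[OF h])
  then have "n = Ident C (Dom C (pb2 C h a))"
    using a h by - (rule pb_eqI[of a h]; simp)
  then show "FM (pb_func C h) (Ident (slice C (Cod C h)) a)
      = Ident (slice C (Dom C h)) (FO (pb_func C h) a)"
    using n by (simp add: pb_func_def)
next
  fix t assume t: "t \<in> Arr (slice C (Cod C h))"
  then obtain a m b where t': "t = (a, m, b)"
    by (rule Arr_slice_triple)
  with t obtain n where n: "FM (pb_func C h) t = (pb2 C h a, n, pb2 C h b)"
    "n \<in> Arr C" "Dom C n = Dom C (pb2 C h a)" "Cod C n = Dom C (pb2 C h b)"
    "pb1 C h b \<cdot> n = m \<cdot> pb1 C h a" "pb2 C h b \<cdot> n = pb2 C h a"
    by (metis pb_func_FM[OF h])
  then show "FM (pb_func C h) t \<in> Hom (slice C (Dom C h))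
      (FO (pb_func C h) (Dom (slice C (Cod C h)) t)) (FO (pb_func C h) (Cod (slice C (Cod C h)) t))"
    using t t' h by (simp add: Hom_def) (simp add: pb_func_def)
  fix s assume s: "s \<in> Arr (slice C (Cod C h))" "Cod (slice C (Cod C h)) t = Dom (slice C (Cod C h)) s"
  then obtain k c where s': "s = (b, k, c)"
    using t' by (metis Arr_slice_triple slice_simps(3,4))
  with s obtain n' where n': "FM (pb_func C h) s = (pb2 C h b, n', pb2 C h c)"
    "n' \<in> Arr C" "Dom C n' = Dom C (pb2 C h b)" "Cod C n' = Dom C (pb2 C h c)"
    "pb1 C h c \<cdot> n' = k \<cdot> pb1 C h b" "pb2 C h c \<cdot> n' = pb2 C h b"
    by (metis pb_func_FM[OF h])
  have mk: "m \<in> Arr C" "Dom C m = Dom C a" "Cod C m = Dom C b" "k \<in> Arr C" "Dom C k = Dom C b" "Cod C k = Dom C c"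
    and abc: "a \<in> Arr C" "Cod C a = Cod C h" "b \<in> Arr C" "Cod C b = Cod C h" "c \<in> Arr C" "Cod C c = Cod C h"
    using s s' t t' by simp_all
  have st: "s \<cdot>\<^bsub>slice C (Cod C h)\<^esub> t = (a, k \<cdot> m, c)"
    using s' t' by simp
  have "category (slice C (Cod C h))"
    by (rule category_slice)
  then have "(a, k \<cdot> m, c) \<in> Arr (slice C (Cod C h))"
    using s t by (simp only: category.Comp_Arr flip: st)
  then obtain l where l: "FM (pb_func C h) (a, k \<cdot> m, c) = (pb2 C h a, l, pb2 C h c)"
    "l \<in> Arr C" "Dom C l = Dom C (pb2 C h a)" "Cod C l = Dom C (pb2 C h c)"
    "pb1 C h c \<cdot> l = (k \<cdot> m) \<cdot> pb1 C h a" "pb2 C h c \<cdot> l = pb2 C h a"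
    by (rule pb_func_FM[OF h])
  have "pb1 C h c \<cdot> (n' \<cdot> n) = (pb1 C h c \<cdot> n') \<cdot> n"
    using n(2-4) n'(2-4) abc h by simp
  also have "\<dots> = k \<cdot> (pb1 C h b \<cdot> n)"
    using n(2-4) n'(2-5) abc mk h by simp
  also have "\<dots> = pb1 C h c \<cdot> l"
    using n(5) l(5) abc mk h by simp
  finally have 1: "pb1 C h c \<cdot> (n' \<cdot> n) = pb1 C h c \<cdot> l" .
  have "pb2 C h c \<cdot> (n' \<cdot> n) = (pb2 C h c \<cdot> n') \<cdot> n"
    using n(2-4) n'(2-4) abc h by simp
  also have "\<dots> = pb2 C h c \<cdot> l"
    using n n' l by simp
  finally have "n' \<cdot> n = l"
    using 1 n(2-4) n'(2-4) l(2-4) abc h by - (rule pb_eqI[of c h]; simp)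
  then show "FM (pb_func C h) (s \<cdot>\<^bsub>slice C (Cod C h)\<^esub> t) =
      FM (pb_func C h) s \<cdot>\<^bsub>slice C (Dom C h)\<^esub> FM (pb_func C h) t"
    using n(1) n'(1) l(1) st by simp
qed

text \<open>The square with sides \<open>h\<close>, \<open>h\<close> and two identities is also a pullback.\<close>

lemma pb2_along_Ident_iso:
  assumes h: "h \<in> Arr C"
  shows "is_iso C (pb2 C h (Ident C (Cod C h)))"
proof -
  let ?a = "Ident C (Cod C h)"
  have "is_pullback C ?a h h (Ident C (Dom C h))"
    unfolding is_pullback_def
  proof (intro conjI ballI impI, goal_cases)
    case (10 s t)
    then have "s = h \<cdot> t" and t: "t \<in> Arr C" "Cod C t = Dom C h"
      using h unit_laws(2)[of s "Cod C h"] by simp_all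
    show ?case
    proof (rule ex1I[of _ t])
      show "t \<in> Hom C (Dom C s) (Dom C h) \<and> h \<cdot> t = s \<and> Ident C (Dom C h) \<cdot> t = t"
        using h t by (simp add: \<open>s = h \<cdot> t\<close> Hom_def)
    next
      fix u assume "u \<in> Hom C (Dom C s) (Dom C h) \<and> h \<cdot> u = s \<and> Ident C (Dom C h) \<cdot> u = t"
      then show "u = t"
        using unit_laws(2)[of u "Dom C h"] by (simp add: Hom_def)
    qed
  qed (use h in simp_all)
  moreover have "is_pullback C ?a h (pb1 C h ?a) (pb2 C h ?a)"
    using h by (intro pb_is_pullback) simp_all
  ultimately obtain i where i: "is_iso C i" "Dom C i = Dom C (pb1 C h ?a)" "Cod C i = Dom C h"
    "Ident C (Dom C h) \<cdot> i = pb2 C h ?a"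
    by (rule pullback_comparison_iso)
  moreover from i have "i \<in> Arr C"
    by (simp add: is_iso_def)
  ultimately have "i = pb2 C h ?a"
    by simp
  with i show ?thesis
    by simp
qed

end

section \<open>Local connectedness as a fibration property\<close>

locale essential_morphism =
  F: category_with_pullbacks F + E: category_with_pullbacks E +
  left_adjoint F E "shriek F E f" "inv_im f" \<eta> "shriek_counit F E f"
  for F :: "('p, 'n) cat" and E :: "('o, 'm) cat" and f :: "('p, 'n, 'o, 'm) geom" and \<eta>
begin

abbreviation "L \<equiv> shriek F E f"
abbreviation "R \<equiv> inv_im f"

lemma shriek_transpose_eq_flat: "shriek_transpose F E f e \<alpha> = flat e \<alpha>"
  by (simp add: shriek_transpose_def flat_def)

lemma slice_shriek_functor:
  assumes "e \<in> Obj E"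
  shows "is_functor (slice F (FO R e)) (slice E e) (slice_shriek F E f e)"
  unfolding is_functor_def
  using assms
  by (auto simp: slice_shriek_def shriek_transpose_eq_flat Hom_def F.category_slice E.category_slice
      simp flip: flat_Comp elim!: Arr_slice_triple)

text \<open>Transposing the commutative pullback square over \<open>\<alpha>\<close> and \<open>R h\<close> gives a cone over the transpose of
  \<open>\<alpha>\<close> and \<open>h\<close>, so the definite description in \<open>comparison\<close> denotes the arrow that this cone induces.\<close>

lemma comparisonE:
  assumes h: "h \<in> Arr E" and \<alpha>: "\<alpha> \<in> Arr F" "Cod F \<alpha> = FO R (Cod E h)"
  obtains m where "comparison F E f h \<alpha> = (flat (Dom E h) (pb2 F (FM R h) \<alpha>), m, pb2 E h (flat (Cod E h) \<alpha>))"
    "m \<in> Arr E" "Dom E m = FO L (Dom F (pb2 F (FM R h) \<alpha>))"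
    "Cod E m = Dom E (pb2 E h (flat (Cod E h) \<alpha>))"
    "pb1 E h (flat (Cod E h) \<alpha>) \<cdot>\<^bsub>E\<^esub> m = FM L (pb1 F (FM R h) \<alpha>)"
    "pb2 E h (flat (Cod E h) \<alpha>) \<cdot>\<^bsub>E\<^esub> m = flat (Dom E h) (pb2 F (FM R h) \<alpha>)"
proof -
  let ?p = "pb1 F (FM R h) \<alpha>" and ?q = "pb2 F (FM R h) \<alpha>" and ?a = "flat (Cod E h) \<alpha>"
  let ?P = "\<lambda>m. m \<in> Hom E (FO L (Dom F ?q)) (Dom E (pb2 E h ?a)) \<and>
    pb1 E h ?a \<cdot>\<^bsub>E\<^esub> m = FM L ?p \<and> pb2 E h ?a \<cdot>\<^bsub>E\<^esub> m = flat (Dom E h) ?q"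
  have "?a \<cdot>\<^bsub>E\<^esub> FM L ?p = flat (Cod E h) (FM R h \<cdot>\<^bsub>F\<^esub> ?q)"
    using h \<alpha> by (simp flip: flat_Comp add: F.pb_commutes)
  also have "\<dots> = h \<cdot>\<^bsub>E\<^esub> flat (Dom E h) ?q"
    using h \<alpha> by (simp add: flat_FM_Comp)
  finally have "\<exists>!m. m \<in> Hom E (Dom E (FM L ?p)) (Dom E (pb1 E h ?a)) \<and>
    pb1 E h ?a \<cdot>\<^bsub>E\<^esub> m = FM L ?p \<and> pb2 E h ?a \<cdot>\<^bsub>E\<^esub> m = flat (Dom E h) ?q"
    using h \<alpha> by (intro pullback_ex1[OF E.pb_is_pullback]) simp_all
  then have "\<exists>!m. ?P m"
    using h \<alpha> by simp
  from theI'[OF this] show thesis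
    by (intro that[of "THE m. ?P m"])
      (simp_all add: comparison_def Let_def shriek_transpose_eq_flat Hom_def)
qed

text \<open>Both composites have the same projections from the pullback in \<open>E\<close>: to \<open>L (Dom b)\<close> the image
  of a composite in \<open>F\<close>, and to \<open>Dom h\<close> the structure arrow of the object over \<open>Dom h\<close>.\<close>

lemma comparison_natural:
  assumes h: "h \<in> Arr E" and t: "t \<in> Arr (slice F (FO R (Cod E h)))"
  defines "S \<equiv> comp_func (slice_shriek F E f (Dom E h)) (pb_func F (FM R h))"
    and "T \<equiv> comp_func (pb_func E h) (slice_shriek F E f (Cod E h))"
    and "X \<equiv> slice F (FO R (Cod E h))" and "Y \<equiv> slice E (Dom E h)"
  shows "comparison F E f h (Cod X t) \<cdot>\<^bsub>Y\<^esub> FM S t = FM T t \<cdot>\<^bsub>Y\<^esub> comparison F E f h (Dom X t)"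
proof -
  let ?k = "FM R h" and ?c = "flat (Cod E h)"
  obtain a m b where t': "t = (a, m, b)" and a: "a \<in> Arr F" "Cod F a = FO R (Cod E h)"
    and b: "b \<in> Arr F" "Cod F b = FO R (Cod E h)"
    and m: "m \<in> Arr F" "Dom F m = Dom F a" "Cod F m = Dom F b" "b \<cdot>\<^bsub>F\<^esub> m = a"
    by (rule Arr_slice_triple[OF t])
  obtain i where i: "comparison F E f h a = (flat (Dom E h) (pb2 F ?k a), i, pb2 E h (?c a))"
    "i \<in> Arr E" "Dom E i = FO L (Dom F (pb2 F ?k a))" "Cod E i = Dom E (pb2 E h (?c a))"
    "pb1 E h (?c a) \<cdot>\<^bsub>E\<^esub> i = FM L (pb1 F ?k a)" "pb2 E h (?c a) \<cdot>\<^bsub>E\<^esub> i = flat (Dom E h) (pb2 F ?k a)"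
    by (rule comparisonE[OF h a])
  obtain j where j: "comparison F E f h b = (flat (Dom E h) (pb2 F ?k b), j, pb2 E h (?c b))"
    "j \<in> Arr E" "Dom E j = FO L (Dom F (pb2 F ?k b))" "Cod E j = Dom E (pb2 E h (?c b))"
    "pb1 E h (?c b) \<cdot>\<^bsub>E\<^esub> j = FM L (pb1 F ?k b)" "pb2 E h (?c b) \<cdot>\<^bsub>E\<^esub> j = flat (Dom E h) (pb2 F ?k b)"
    by (rule comparisonE[OF h b])
  have "(a, m, b) \<in> Arr (slice F (Cod F ?k))"
    using t t' h by simp
  then obtain n where n: "FM (pb_func F ?k) (a, m, b) = (pb2 F ?k a, n, pb2 F ?k b)"
    "n \<in> Arr F" "Dom F n = Dom F (pb2 F ?k a)" "Cod F n = Dom F (pb2 F ?k b)"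
    "pb1 F ?k b \<cdot>\<^bsub>F\<^esub> n = m \<cdot>\<^bsub>F\<^esub> pb1 F ?k a" "pb2 F ?k b \<cdot>\<^bsub>F\<^esub> n = pb2 F ?k a"
    using h by (elim F.pb_func_FM[rotated]) simp_all
  have "(?c a, FM L m, ?c b) \<in> Arr (slice E (Cod E h))"
    using a b m h by (auto simp flip: flat_Comp)
  then obtain l where l: "FM (pb_func E h) (?c a, FM L m, ?c b) = (pb2 E h (?c a), l, pb2 E h (?c b))"
    "l \<in> Arr E" "Dom E l = Dom E (pb2 E h (?c a))" "Cod E l = Dom E (pb2 E h (?c b))"
    "pb1 E h (?c b) \<cdot>\<^bsub>E\<^esub> l = FM L m \<cdot>\<^bsub>E\<^esub> pb1 E h (?c a)" "pb2 E h (?c b) \<cdot>\<^bsub>E\<^esub> l = pb2 E h (?c a)"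
    by (rule E.pb_func_FM[OF h])
  have ca: "?c a \<in> Arr E" "Cod E (?c a) = Cod E h" "Dom E (?c a) = FO L (Dom F a)"
    and cb: "?c b \<in> Arr E" "Cod E (?c b) = Cod E h" "Dom E (?c b) = FO L (Dom F b)"
    using a b h by simp_all
  have "pb1 E h (?c b) \<cdot>\<^bsub>E\<^esub> (j \<cdot>\<^bsub>E\<^esub> FM L n) = (pb1 E h (?c b) \<cdot>\<^bsub>E\<^esub> j) \<cdot>\<^bsub>E\<^esub> FM L n"
    using j(2-4) n(2-4) cb h by simp
  also have "\<dots> = FM L (m \<cdot>\<^bsub>F\<^esub> pb1 F ?k a)"
    using j(5) n(2-5) a b h by (simp flip: L.FM_Comp)
  also have "\<dots> = FM L m \<cdot>\<^bsub>E\<^esub> (pb1 E h (?c a) \<cdot>\<^bsub>E\<^esub> i)"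
    using i(5) a m h by simp
  also have "\<dots> = (FM L m \<cdot>\<^bsub>E\<^esub> pb1 E h (?c a)) \<cdot>\<^bsub>E\<^esub> i"
    using i(2-4) ca h m by simp
  also have "\<dots> = (pb1 E h (?c b) \<cdot>\<^bsub>E\<^esub> l) \<cdot>\<^bsub>E\<^esub> i"
    using l by simp
  also have "\<dots> = pb1 E h (?c b) \<cdot>\<^bsub>E\<^esub> (l \<cdot>\<^bsub>E\<^esub> i)"
    using l(2-4) i(2-4) cb h by simp
  finally have 1: "pb1 E h (?c b) \<cdot>\<^bsub>E\<^esub> (j \<cdot>\<^bsub>E\<^esub> FM L n) = pb1 E h (?c b) \<cdot>\<^bsub>E\<^esub> (l \<cdot>\<^bsub>E\<^esub> i)" .
  have "pb2 E h (?c b) \<cdot>\<^bsub>E\<^esub> (j \<cdot>\<^bsub>E\<^esub> FM L n) = (pb2 E h (?c b) \<cdot>\<^bsub>E\<^esub> j) \<cdot>\<^bsub>E\<^esub> FM L n"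
    using j(2-4) n(2-4) cb h by simp
  also have "\<dots> = flat (Dom E h) (pb2 F ?k a)"
    using j(6) n(2-6) a b h by (simp flip: flat_Comp)
  also have "\<dots> = (pb2 E h (?c b) \<cdot>\<^bsub>E\<^esub> l) \<cdot>\<^bsub>E\<^esub> i"
    using l(6) i(6) by simp
  also have "\<dots> = pb2 E h (?c b) \<cdot>\<^bsub>E\<^esub> (l \<cdot>\<^bsub>E\<^esub> i)"
    using l(2-4) i(2-4) cb h by simp
  finally have "j \<cdot>\<^bsub>E\<^esub> FM L n = l \<cdot>\<^bsub>E\<^esub> i"
    using 1 j(2-4) n(2-4) l(2-4) i(2-4) cb h by - (rule E.pb_eqI[of "?c b" h]; simp)
  then show ?thesis
    unfolding X_def Y_def S_def T_def comp_func_def t'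
    by (simp add: i(1) j(1) n(1) slice_shriek_def shriek_transpose_eq_flat l(1))
qed

text \<open>The functors and the naturality always exist, so local connectedness is a condition on the
  individual comparison arrows.\<close>

lemma comparison_nat_iso_iff:
  assumes h: "h \<in> Arr E"
  shows "nat_iso (slice F (FO R (Cod E h))) (slice E (Dom E h))
      (comp_func (slice_shriek F E f (Dom E h)) (pb_func F (FM R h)))
      (comp_func (pb_func E h) (slice_shriek F E f (Cod E h))) (comparison F E f h) \<longleftrightarrow>
    (\<forall>\<alpha> \<in> Arr F. Cod F \<alpha> = FO R (Cod E h) \<longrightarrow> is_iso E (fst (snd (comparison F E f h \<alpha>))))"
    (is "nat_iso ?X ?Y ?S ?T _ \<longleftrightarrow> _")
proof -
  have Arr: "comparison F E f h \<alpha> \<in> Hom ?Y (FO ?S \<alpha>) (FO ?T \<alpha>)"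
    and iso: "is_iso ?Y (comparison F E f h \<alpha>) \<longleftrightarrow> is_iso E (fst (snd (comparison F E f h \<alpha>)))"
    if \<alpha>: "\<alpha> \<in> Arr F" "Cod F \<alpha> = FO R (Cod E h)" for \<alpha>
  proof -
    obtain m where m: "comparison F E f h \<alpha> = (flat (Dom E h) (pb2 F (FM R h) \<alpha>), m, pb2 E h (flat (Cod E h) \<alpha>))"
      "m \<in> Arr E" "Dom E m = FO L (Dom F (pb2 F (FM R h) \<alpha>))"
      "Cod E m = Dom E (pb2 E h (flat (Cod E h) \<alpha>))"
      "pb2 E h (flat (Cod E h) \<alpha>) \<cdot>\<^bsub>E\<^esub> m = flat (Dom E h) (pb2 F (FM R h) \<alpha>)"
      by (rule comparisonE[OF h \<alpha>])
    have t: "comparison F E f h \<alpha> \<in> Arr ?Y"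
      unfolding m(1) slice_simps using m(2-5) h \<alpha> by simp
    then show "comparison F E f h \<alpha> \<in> Hom ?Y (FO ?S \<alpha>) (FO ?T \<alpha>)"
      using h \<alpha>
      by (simp add: m(1) Hom_def comp_func_def slice_shriek_def pb_func_def shriek_transpose_eq_flat)
    show "is_iso ?Y (comparison F E f h \<alpha>) \<longleftrightarrow> is_iso E (fst (snd (comparison F E f h \<alpha>)))"
      using E.iso_slice_iff[OF t[unfolded m(1)]] by (simp add: m(1))
  qed
  have "is_functor ?X ?Y ?S"
    using h F.pb_func_functor[of "FM R h"] by (intro is_functor_comp[OF _ slice_shriek_functor]) simp_all
  moreover have "is_functor ?X ?Y ?T"
    using h by (intro is_functor_comp[OF slice_shriek_functor E.pb_func_functor]) simp_all
  ultimately have "nat_trans ?X ?Y ?S ?T (comparison F E f h)"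
    unfolding nat_trans_def using Arr comparison_natural[OF h] by simp
  then show ?thesis
    unfolding nat_iso_def using iso by auto
qed

text \<open>At the unit \<open>\<eta> d\<close>, whose transpose is an identity, the pullback in \<open>E\<close> is \<open>Dom u\<close> itself, and the
  comparison becomes the transpose of the projection to \<open>R (Dom u)\<close>.\<close>

lemma street_fibration_if_comparisons_iso:
  assumes iso: "\<And>h \<alpha>. \<lbrakk>h \<in> Arr E; \<alpha> \<in> Arr F; Cod F \<alpha> = FO R (Cod E h)\<rbrakk>
    \<Longrightarrow> is_iso E (fst (snd (comparison F E f h \<alpha>)))"
  shows "street_fibration F E L"
  unfolding street_fibration_def
proof (intro conjI ballI impI)
  show "is_functor F E L"
    by (rule L.functor_T)
next
  fix d u
  assume d: "d \<in> Obj F" and u: "u \<in> Arr E" "Cod E u = FO L d"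
  let ?v = "pb1 F (FM R u) (\<eta> d)" and ?q = "pb2 F (FM R u) (\<eta> d)"
  let ?\<sigma> = "flat (Dom E u) ?q"
  have \<eta>d: "\<eta> d \<in> Arr F" "Cod F (\<eta> d) = FO R (Cod E u)"
    using d u by simp_all
  obtain m where m: "comparison F E f u (\<eta> d) = (?\<sigma>, m, pb2 E u (flat (Cod E u) (\<eta> d)))"
    "m \<in> Arr E" "Dom E m = FO L (Dom F ?q)" "Cod E m = Dom E (pb2 E u (flat (Cod E u) (\<eta> d)))"
    "pb2 E u (flat (Cod E u) (\<eta> d)) \<cdot>\<^bsub>E\<^esub> m = ?\<sigma>"
    by (rule comparisonE[OF u(1) \<eta>d])
  have "flat (Cod E u) (\<eta> d) = Ident E (Cod E u)"
    using d u by (simp add: flat_unit)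
  moreover have "is_iso E m"
    using iso[OF u(1) \<eta>d] m(1) by simp
  ultimately have \<sigma>: "is_iso E ?\<sigma>"
    using m E.pb2_along_Ident_iso[OF u(1)] E.iso_comp[of m "pb2 E u (Ident E (Cod E u))"] by simp
  have pb: "is_pullback F (\<eta> d) (FM R u) ?v ?q"
    using \<eta>d u by (intro F.pb_is_pullback) simp_all
  have "cartesian_arrow F E L ?v" "FM L ?v = u \<cdot>\<^bsub>E\<^esub> ?\<sigma>"
    using pullback_along_unit_cartesian[OF u d pb \<sigma>] by simp_all
  moreover have "Cod F ?v = d" "?\<sigma> \<in> Hom E (FO L (Dom F ?v)) (Dom E u)"
    using d u by (simp_all add: Hom_def)
  ultimately show "\<exists>v \<sigma>. cartesian_arrow F E L v \<and> Cod F v = d \<and>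
      \<sigma> \<in> Hom E (FO L (Dom F v)) (Dom E u) \<and> is_iso E \<sigma> \<and> FM L v = u \<cdot>\<^bsub>E\<^esub> \<sigma>"
    using \<sigma> by blast
qed

text \<open>The chosen pullback in \<open>F\<close> is isomorphic, by some \<open>i\<close>, to the one built from the cartesian lift
  of the projection \<open>u\<close>. Along \<open>L i\<close> the comparison becomes the isomorphism \<open>\<sigma>\<close> that comes with
  the lift.\<close>

lemma comparison_iso_if_street_fibration:
  assumes fib: "street_fibration F E L"
    and h: "h \<in> Arr E" and \<alpha>: "\<alpha> \<in> Arr F" "Cod F \<alpha> = FO R (Cod E h)"
  shows "is_iso E (fst (snd (comparison F E f h \<alpha>)))"
proof -
  let ?a = "flat (Cod E h) \<alpha>"
  let ?u = "pb1 E h ?a" and ?w = "pb2 E h ?a" and ?p = "pb1 F (FM R h) \<alpha>" and ?q = "pb2 F (FM R h) \<alpha>"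
  have u: "?u \<in> Arr E" "Cod E ?u = FO L (Dom F \<alpha>)" and w: "?w \<in> Arr E" "Dom E ?w = Dom E ?u" "Cod E ?w = Dom E h"
    using h \<alpha> by simp_all
  have "Dom F \<alpha> \<in> Obj F"
    using \<alpha> by simp
  then obtain v \<sigma> where v: "cartesian_arrow F E L v" "Cod F v = Dom F \<alpha>" "FM L v = ?u \<cdot>\<^bsub>E\<^esub> \<sigma>"
    and \<sigma>: "\<sigma> \<in> Hom E (FO L (Dom F v)) (Dom E ?u)" "is_iso E \<sigma>"
    using fib u unfolding street_fibration_def by meson
  have v': "v \<in> Arr F"
    using v by (simp add: cartesian_arrow_def)
  have \<sigma>': "\<sigma> \<in> Arr E" "Dom E \<sigma> = FO L (Dom F v)" "Cod E \<sigma> = Dom E ?u"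
    using \<sigma> by (simp_all add: Hom_def)
  let ?r = "sharp (Dom F v) (?w \<cdot>\<^bsub>E\<^esub> \<sigma>)"
  have pbE: "is_pullback E ?a h ?u ?w"
    using h \<alpha> by (intro E.pb_is_pullback) simp_all
  have pbF: "is_pullback F \<alpha> (FM R h) v ?r"
    by (rule cartesian_lift_pullback[OF h \<alpha> pbE v \<sigma>(2) \<sigma>'(2,3)])
  have "is_pullback F \<alpha> (FM R h) ?p ?q"
    using h \<alpha> by (intro F.pb_is_pullback) simp_all
  with pbF obtain i where i: "is_iso F i" "Dom F i = Dom F ?p" "Cod F i = Dom F v"
    "v \<cdot>\<^bsub>F\<^esub> i = ?p" "?r \<cdot>\<^bsub>F\<^esub> i = ?q"
    by (rule F.pullback_comparison_iso)
  have i': "i \<in> Arr F"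
    using i by (simp add: is_iso_def)
  obtain m where m: "comparison F E f h \<alpha> = (flat (Dom E h) ?q, m, ?w)"
    "m \<in> Arr E" "Dom E m = FO L (Dom F ?q)" "Cod E m = Dom E ?w"
    "?u \<cdot>\<^bsub>E\<^esub> m = FM L ?p" "?w \<cdot>\<^bsub>E\<^esub> m = flat (Dom E h) ?q"
    by (rule comparisonE[OF h \<alpha>])
  have pq: "Dom F ?p = Dom F ?q"
    using h \<alpha> by simp
  have "?u \<cdot>\<^bsub>E\<^esub> (\<sigma> \<cdot>\<^bsub>E\<^esub> FM L i) = FM L v \<cdot>\<^bsub>E\<^esub> FM L i"
    using u \<sigma>' i' i(3) v' by (simp add: v(3))
  also have "\<dots> = ?u \<cdot>\<^bsub>E\<^esub> m"
    using v' i' i(3,4) m(5) by (simp flip: L.FM_Comp)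
  finally have 1: "?u \<cdot>\<^bsub>E\<^esub> (\<sigma> \<cdot>\<^bsub>E\<^esub> FM L i) = ?u \<cdot>\<^bsub>E\<^esub> m" .
  have "?w \<cdot>\<^bsub>E\<^esub> (\<sigma> \<cdot>\<^bsub>E\<^esub> FM L i) = flat (Dom E h) ?r \<cdot>\<^bsub>E\<^esub> FM L i"
    using w \<sigma>' i' i(3) v' by (simp add: flat_sharp)
  also have "\<dots> = flat (Dom E h) (?r \<cdot>\<^bsub>F\<^esub> i)"
    using w \<sigma>' i' i(3) v' h by (simp add: flat_Comp)
  also have "\<dots> = ?w \<cdot>\<^bsub>E\<^esub> m"
    using i(5) m(6) by simp
  finally have "\<sigma> \<cdot>\<^bsub>E\<^esub> FM L i = m"
    using 1 u w \<sigma>' i' i(2,3) m(2-4) pq by - (rule E.pullback_eqI[OF pbE]; simp)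
  moreover have "is_iso E (\<sigma> \<cdot>\<^bsub>E\<^esub> FM L i)"
    using \<sigma>' i' i(3) by (intro E.iso_comp L.FM_iso[OF i(1)] \<sigma>(2)) simp
  ultimately show ?thesis
    by (simp add: m(1))
qed

theorem comparisons_nat_iso_iff_street_fibration:
  "(\<forall>h \<in> Arr E. nat_iso (slice F (FO R (Cod E h))) (slice E (Dom E h))
      (comp_func (slice_shriek F E f (Dom E h)) (pb_func F (FM R h)))
      (comp_func (pb_func E h) (slice_shriek F E f (Cod E h))) (comparison F E f h)) \<longleftrightarrow>
    street_fibration F E L"
  using street_fibration_if_comparisons_iso comparison_iso_if_street_fibration
  by (auto simp: comparison_nat_iso_iff)

end

section \<open>Finite limits and equivalences\<close>

lemma functor_cone:
  assumes "is_cone J C T x \<pi>" "is_functor J C T" "is_functor C D S"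
  shows "is_cone J D (comp_func S T) (FO S x) (\<lambda>j. FM S (\<pi> j))"
proof -
  interpret T: functor_between J C T by (rule functor_betweenI[OF assms(2)])
  interpret S: functor_between C D S by (rule functor_betweenI[OF assms(3)])
  note c = is_coneD[OF assms(1)]
  show ?thesis
  proof (rule is_coneI)
    fix k assume k: "k \<in> Arr J"
    have "FM S (FM T k) \<cdot>\<^bsub>D\<^esub> FM S (\<pi> (Dom J k)) = FM S (FM T k \<cdot>\<^bsub>C\<^esub> \<pi> (Dom J k))"
      using k by (simp add: c(2-4))
    then show "FM (comp_func S T) k \<cdot>\<^bsub>D\<^esub> FM S (\<pi> (Dom J k)) = FM S (\<pi> (Cod J k))"
      using k by (simp add: c comp_func_def)
  qed (simp_all add: c comp_func_def)
qed

text \<open>Apply \<open>V\<close> to the limit cone and return to \<open>T\<close> along the inverse of \<open>\<eta>\<close>. A cone over \<open>T\<close> is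
  sent by \<open>S\<close> to a cone in \<open>D\<close>, whose factorisation is carried back by \<open>V\<close>. For uniqueness,
  two factorisations become equal under \<open>S\<close> followed by \<open>\<epsilon>\<close>, and \<open>S\<close> is faithful because \<open>\<eta>\<close>
  is invertible.\<close>

lemma limit_if_equivalent:
  assumes S: "is_functor C D S" and V: "is_functor D C V"
    and \<eta>: "nat_iso C C id_func (comp_func V S) \<eta>" and \<epsilon>: "nat_iso D D (comp_func S V) id_func \<epsilon>"
    and T: "is_functor J C T" and lim: "is_limit J D (comp_func S T) x \<pi>"
  shows "\<exists>\<rho>. is_limit J C T (FO V x) \<rho>"
proof -
  interpret S: functor_between C D S by (rule functor_betweenI[OF S])
  interpret V: functor_between D C V by (rule functor_betweenI[OF V])
  interpret T: functor_between J C T by (rule functor_betweenI[OF T])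
  have \<eta>_iso: "is_iso C (\<eta> a)" if "a \<in> Obj C" for a
    using \<eta> that by (simp add: nat_iso_def)
  have \<eta>_arr: "\<eta> a \<in> Arr C" "Dom C (\<eta> a) = a" "Cod C (\<eta> a) = FO V (FO S a)" if "a \<in> Obj C" for a
    using \<eta> that by (auto simp: nat_iso_def nat_trans_def Hom_def id_func_def comp_func_def)
  have \<eta>_nat: "\<eta> (Cod C g) \<cdot>\<^bsub>C\<^esub> g = FM V (FM S g) \<cdot>\<^bsub>C\<^esub> \<eta> (Dom C g)" if "g \<in> Arr C" for g
    using \<eta> that by (auto simp: nat_iso_def nat_trans_def id_func_def comp_func_def)
  have \<epsilon>_iso: "is_iso D (\<epsilon> b)" if "b \<in> Obj D" for b
    using \<epsilon> that by (simp add: nat_iso_def)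
  have \<epsilon>_arr: "\<epsilon> b \<in> Arr D" "Dom D (\<epsilon> b) = FO S (FO V b)" "Cod D (\<epsilon> b) = b" if "b \<in> Obj D" for b
    using \<epsilon> that by (auto simp: nat_iso_def nat_trans_def Hom_def id_func_def comp_func_def)
  have \<epsilon>_nat: "\<epsilon> (Cod D g) \<cdot>\<^bsub>D\<^esub> FM S (FM V g) = g \<cdot>\<^bsub>D\<^esub> \<epsilon> (Dom D g)" if "g \<in> Arr D" for g
    using \<epsilon> that by (auto simp: nat_iso_def nat_trans_def id_func_def comp_func_def)
  have "\<forall>a \<in> Obj C. \<exists>g. g \<in> Arr C \<and> Dom C g = FO V (FO S a) \<and> Cod C g = a \<and>
      g \<cdot>\<^bsub>C\<^esub> \<eta> a = Ident C a \<and> \<eta> a \<cdot>\<^bsub>C\<^esub> g = Ident C (FO V (FO S a))"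
    using \<eta>_iso \<eta>_arr by (metis S.C.isoE)
  then obtain \<theta> where \<theta>: "\<theta> a \<in> Arr C" "Dom C (\<theta> a) = FO V (FO S a)" "Cod C (\<theta> a) = a"
      "\<theta> a \<cdot>\<^bsub>C\<^esub> \<eta> a = Ident C a" "\<eta> a \<cdot>\<^bsub>C\<^esub> \<theta> a = Ident C (FO V (FO S a))" if "a \<in> Obj C" for a
    by metis
  have cone: "is_cone J D (comp_func S T) x \<pi>"
    using lim by (simp add: is_limit_def)
  note c = is_coneD[OF cone]
  have c4: "Cod D (\<pi> j) = FO S (FO T j)" if "j \<in> Obj J" for j
    using c(4)[OF that] by (simp add: comp_func_def)
  have c5: "FM S (FM T k) \<cdot>\<^bsub>D\<^esub> \<pi> (Dom J k) = \<pi> (Cod J k)" if "k \<in> Arr J" for k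
    using c(5)[OF that] by (simp add: comp_func_def)
  let ?\<rho> = "\<lambda>j. \<theta> (FO T j) \<cdot>\<^bsub>C\<^esub> FM V (\<pi> j)"
  have \<rho>_arr: "?\<rho> j \<in> Arr C" "Dom C (?\<rho> j) = FO V x" "Cod C (?\<rho> j) = FO T j" if "j \<in> Obj J" for j
    using that c(2,3) c4 \<theta>(1-3) by simp_all
  have \<eta>\<rho>: "\<eta> (FO T j) \<cdot>\<^bsub>C\<^esub> ?\<rho> j = FM V (\<pi> j)" if "j \<in> Obj J" for j
  proof -
    have "\<eta> (FO T j) \<cdot>\<^bsub>C\<^esub> ?\<rho> j = (\<eta> (FO T j) \<cdot>\<^bsub>C\<^esub> \<theta> (FO T j)) \<cdot>\<^bsub>C\<^esub> FM V (\<pi> j)"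
      using that c(2,3) c4 \<theta>(1-3) \<eta>_arr by (intro S.C.assoc[symmetric]) simp_all
    then show ?thesis
      using that c(2,3) c4 \<theta>(5) by simp
  qed
  have \<eta>_cancel: "g = g'" if "a \<in> Obj C" "g \<in> Arr C" "g' \<in> Arr C" "Cod C g = a" "Cod C g' = a"
    "\<eta> a \<cdot>\<^bsub>C\<^esub> g = \<eta> a \<cdot>\<^bsub>C\<^esub> g'" for a g g'
    using that \<eta>_arr by - (rule S.C.iso_cancel_left[OF \<eta>_iso[OF that(1)]]; simp)
  have \<rho>_cone: "is_cone J C T (FO V x) ?\<rho>"
  proof (rule is_coneI)
    fix k assume k: "k \<in> Arr J"
    let ?a = "FO T (Dom J k)" and ?b = "FO T (Cod J k)"
    have "\<eta> ?b \<cdot>\<^bsub>C\<^esub> (FM T k \<cdot>\<^bsub>C\<^esub> ?\<rho> (Dom J k)) = (\<eta> ?b \<cdot>\<^bsub>C\<^esub> FM T k) \<cdot>\<^bsub>C\<^esub> ?\<rho> (Dom J k)"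
      using k \<rho>_arr[of "Dom J k"] \<eta>_arr by (intro S.C.assoc[symmetric]) simp_all
    also have "\<dots> = (FM V (FM S (FM T k)) \<cdot>\<^bsub>C\<^esub> \<eta> ?a) \<cdot>\<^bsub>C\<^esub> ?\<rho> (Dom J k)"
      using k \<eta>_nat[of "FM T k"] by simp
    also have "\<dots> = FM V (FM S (FM T k)) \<cdot>\<^bsub>C\<^esub> FM V (\<pi> (Dom J k))"
      using k \<rho>_arr[of "Dom J k"] \<eta>_arr \<eta>\<rho>[of "Dom J k"] by (subst S.C.assoc) simp_all
    also have "\<dots> = FM V (\<pi> (Cod J k))"
      using k c(2,3) c4 c5 by (simp flip: V.FM_Comp)
    also have "\<dots> = \<eta> ?b \<cdot>\<^bsub>C\<^esub> ?\<rho> (Cod J k)"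
      using k \<eta>\<rho>[of "Cod J k"] by simp
    finally show "FM T k \<cdot>\<^bsub>C\<^esub> ?\<rho> (Dom J k) = ?\<rho> (Cod J k)"
      using k \<rho>_arr[of "Dom J k"] \<rho>_arr[of "Cod J k"] by - (rule \<eta>_cancel[of ?b]; simp del: S.C.assoc)
  qed (use c(1) \<rho>_arr in simp_all)
  moreover have "\<exists>!u. u \<in> Hom C y (FO V x) \<and> (\<forall>j \<in> Obj J. ?\<rho> j \<cdot>\<^bsub>C\<^esub> u = \<mu> j)"
    if \<mu>: "is_cone J C T y \<mu>" for y \<mu>
  proof -
    note m = is_coneD[OF \<mu>]
    have "is_cone J D (comp_func S T) (FO S y) (\<lambda>j. FM S (\<mu> j))"
      by (rule functor_cone[OF \<mu> T S])
    with lim obtain w where "w \<in> Hom D (FO S y) x" "\<forall>j \<in> Obj J. \<pi> j \<cdot>\<^bsub>D\<^esub> w = FM S (\<mu> j)"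
      unfolding is_limit_def by blast
    then have w: "w \<in> Arr D" "Dom D w = FO S y" "Cod D w = x"
      and \<pi>w: "\<And>j. j \<in> Obj J \<Longrightarrow> \<pi> j \<cdot>\<^bsub>D\<^esub> w = FM S (\<mu> j)"
      by (auto simp: Hom_def)
    have \<pi>_eqI: "v = v'" if v: "v \<in> Arr D" "v' \<in> Arr D" "Cod D v = x" "Cod D v' = x" "Dom D v = Dom D v'"
      "\<And>j. j \<in> Obj J \<Longrightarrow> \<pi> j \<cdot>\<^bsub>D\<^esub> v = \<pi> j \<cdot>\<^bsub>D\<^esub> v'" for v v'
    proof -
      have "is_cone J D (comp_func S T) (Dom D v) (\<lambda>j. \<pi> j \<cdot>\<^bsub>D\<^esub> v)"
      proof (rule is_coneI)
        fix k assume k: "k \<in> Arr J"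
        have "(FM S (FM T k) \<cdot>\<^bsub>D\<^esub> \<pi> (Dom J k)) \<cdot>\<^bsub>D\<^esub> v = FM S (FM T k) \<cdot>\<^bsub>D\<^esub> (\<pi> (Dom J k) \<cdot>\<^bsub>D\<^esub> v)"
          using k v(1,3) c(2,3) c4 by (intro S.D.assoc) simp_all
        then show "FM (comp_func S T) k \<cdot>\<^bsub>D\<^esub> \<pi> (Dom J k) \<cdot>\<^bsub>D\<^esub> v = \<pi> (Cod J k) \<cdot>\<^bsub>D\<^esub> v"
          using k by (simp add: c5 comp_func_def)
      qed (use v(1,3) c(2,3,4) in simp_all)
      then have "\<exists>!z. z \<in> Hom D (Dom D v) x \<and> (\<forall>j \<in> Obj J. \<pi> j \<cdot>\<^bsub>D\<^esub> z = \<pi> j \<cdot>\<^bsub>D\<^esub> v)"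
        using lim unfolding is_limit_def by blast
      moreover have "v \<in> Hom D (Dom D v) x \<and> (\<forall>j \<in> Obj J. \<pi> j \<cdot>\<^bsub>D\<^esub> v = \<pi> j \<cdot>\<^bsub>D\<^esub> v)"
        "v' \<in> Hom D (Dom D v) x \<and> (\<forall>j \<in> Obj J. \<pi> j \<cdot>\<^bsub>D\<^esub> v' = \<pi> j \<cdot>\<^bsub>D\<^esub> v)"
        using v by (simp_all add: Hom_def)
      ultimately show ?thesis
        by blast
    qed
    let ?u = "FM V w \<cdot>\<^bsub>C\<^esub> \<eta> y"
    have u: "?u \<in> Arr C" "Dom C ?u = y" "Cod C ?u = FO V x"
      using w m(1) \<eta>_arr by simp_all
    have \<rho>u: "?\<rho> j \<cdot>\<^bsub>C\<^esub> ?u = \<mu> j" if j: "j \<in> Obj J" for j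
    proof -
      have "\<eta> (FO T j) \<cdot>\<^bsub>C\<^esub> (?\<rho> j \<cdot>\<^bsub>C\<^esub> ?u) = (\<eta> (FO T j) \<cdot>\<^bsub>C\<^esub> ?\<rho> j) \<cdot>\<^bsub>C\<^esub> ?u"
        using j \<rho>_arr[OF j] u \<eta>_arr by (intro S.C.assoc[symmetric]) simp_all
      also have "\<dots> = FM V (\<pi> j) \<cdot>\<^bsub>C\<^esub> ?u"
        by (simp only: \<eta>\<rho>[OF j])
      also have "\<dots> = (FM V (\<pi> j) \<cdot>\<^bsub>C\<^esub> FM V w) \<cdot>\<^bsub>C\<^esub> \<eta> y"
        using j w m(1) \<eta>_arr c(2,3) by (intro S.C.assoc[symmetric]) simp_all
      also have "FM V (\<pi> j) \<cdot>\<^bsub>C\<^esub> FM V w = FM V (FM S (\<mu> j))"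
        using j w c(2,3) \<pi>w by (simp flip: V.FM_Comp)
      also have "FM V (FM S (\<mu> j)) \<cdot>\<^bsub>C\<^esub> \<eta> y = \<eta> (FO T j) \<cdot>\<^bsub>C\<^esub> \<mu> j"
        using j \<eta>_nat[of "\<mu> j"] m(2-4) by simp
      finally show ?thesis
        using j \<rho>_arr[OF j] u m(2-4) by - (rule \<eta>_cancel[of "FO T j"]; simp del: S.C.assoc)
    qed
    have unique: "v = v'"
      if v: "v \<in> Arr C" "v' \<in> Arr C" "Dom C v = y" "Dom C v' = y" "Cod C v = FO V x" "Cod C v' = FO V x"
        and \<rho>v: "\<And>j. j \<in> Obj J \<Longrightarrow> ?\<rho> j \<cdot>\<^bsub>C\<^esub> v = ?\<rho> j \<cdot>\<^bsub>C\<^esub> v'" for v v'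
    proof -
      have \<pi>\<epsilon>: "\<pi> j \<cdot>\<^bsub>D\<^esub> (\<epsilon> x \<cdot>\<^bsub>D\<^esub> FM S z) =
          \<epsilon> (FO S (FO T j)) \<cdot>\<^bsub>D\<^esub> FM S (\<eta> (FO T j) \<cdot>\<^bsub>C\<^esub> (?\<rho> j \<cdot>\<^bsub>C\<^esub> z))"
        if j: "j \<in> Obj J" and z: "z \<in> Arr C" "Cod C z = FO V x" for j z
      proof -
        have "\<pi> j \<cdot>\<^bsub>D\<^esub> (\<epsilon> x \<cdot>\<^bsub>D\<^esub> FM S z) = (\<pi> j \<cdot>\<^bsub>D\<^esub> \<epsilon> x) \<cdot>\<^bsub>D\<^esub> FM S z"
          using j z c(1-3) \<epsilon>_arr by (intro S.D.assoc[symmetric]) simp_all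
        also have "\<dots> = (\<epsilon> (FO S (FO T j)) \<cdot>\<^bsub>D\<^esub> FM S (FM V (\<pi> j))) \<cdot>\<^bsub>D\<^esub> FM S z"
          using j \<epsilon>_nat[of "\<pi> j"] c(2,3) c4 by simp
        also have "\<dots> = \<epsilon> (FO S (FO T j)) \<cdot>\<^bsub>D\<^esub> FM S (FM V (\<pi> j) \<cdot>\<^bsub>C\<^esub> z)"
          using j z c(2,3) c4 \<epsilon>_arr by simp
        also have "FM V (\<pi> j) \<cdot>\<^bsub>C\<^esub> z = (\<eta> (FO T j) \<cdot>\<^bsub>C\<^esub> ?\<rho> j) \<cdot>\<^bsub>C\<^esub> z"
          by (simp only: \<eta>\<rho>[OF j])
        also have "\<dots> = \<eta> (FO T j) \<cdot>\<^bsub>C\<^esub> (?\<rho> j \<cdot>\<^bsub>C\<^esub> z)"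
          using j z \<rho>_arr[OF j] \<eta>_arr by (intro S.C.assoc) simp_all
        finally show ?thesis .
      qed
      have "\<epsilon> x \<cdot>\<^bsub>D\<^esub> FM S v = \<epsilon> x \<cdot>\<^bsub>D\<^esub> FM S v'"
      proof (rule \<pi>_eqI)
        fix j assume j: "j \<in> Obj J"
        show "\<pi> j \<cdot>\<^bsub>D\<^esub> \<epsilon> x \<cdot>\<^bsub>D\<^esub> FM S v = \<pi> j \<cdot>\<^bsub>D\<^esub> \<epsilon> x \<cdot>\<^bsub>D\<^esub> FM S v'"
          using \<pi>\<epsilon>[OF j v(1,5)] \<pi>\<epsilon>[OF j v(2,6)] \<rho>v[OF j] by simp
      qed (use v c(1) \<epsilon>_arr in simp_all)
      then have "FM S v = FM S v'"
        using v c(1) \<epsilon>_arr by - (rule S.D.iso_cancel_left[OF \<epsilon>_iso[OF c(1)]]; simp)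
      then have "\<eta> (FO V x) \<cdot>\<^bsub>C\<^esub> v = \<eta> (FO V x) \<cdot>\<^bsub>C\<^esub> v'"
        using \<eta>_nat[of v] \<eta>_nat[of v'] v by simp
      then show ?thesis
        using v c(1) by - (rule \<eta>_cancel[of "FO V x"]; simp)
    qed
    show ?thesis
    proof (rule ex1I[of _ ?u])
      show "?u \<in> Hom C y (FO V x) \<and> (\<forall>j \<in> Obj J. ?\<rho> j \<cdot>\<^bsub>C\<^esub> ?u = \<mu> j)"
        using u \<rho>u unfolding Hom_def by blast
    next
      fix v assume "v \<in> Hom C y (FO V x) \<and> (\<forall>j \<in> Obj J. ?\<rho> j \<cdot>\<^bsub>C\<^esub> v = \<mu> j)"
      then have v: "v \<in> Arr C" "Dom C v = y" "Cod C v = FO V x"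
        and \<rho>v: "\<And>j. j \<in> Obj J \<Longrightarrow> ?\<rho> j \<cdot>\<^bsub>C\<^esub> v = \<mu> j"
        unfolding Hom_def by blast+
      show "v = ?u"
        by (rule unique[OF v(1) u(1) v(2) u(2) v(3) u(3)]) (simp only: \<rho>v \<rho>u)
    qed
  qed
  ultimately have "is_limit J C T (FO V x) ?\<rho>"
    unfolding is_limit_def by blast
  then show ?thesis
    by blast
qed

lemma has_finite_limits_if_equivalent:
  assumes "equivalent C D" "has_finite_limits D"
  shows "has_finite_limits C"
  unfolding has_finite_limits_def
proof (intro allI impI, elim conjE)
  fix J T assume J: "finite_category J" and T: "is_functor J C T"
  from assms(1) obtain S V \<eta> \<epsilon> where eq: "is_functor C D S" "is_functor D C V"
    "nat_iso C C id_func (comp_func V S) \<eta>" "nat_iso D D (comp_func S V) id_func \<epsilon>"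
    unfolding equivalent_def by blast
  have "is_functor J D (comp_func S T)"
    by (rule is_functor_comp[OF T eq(1)])
  with assms(2) J obtain x \<pi> where "is_limit J D (comp_func S T) x \<pi>"
    unfolding has_finite_limits_def by blast
  with limit_if_equivalent[OF eq T] show "\<exists>x \<pi>. is_limit J C T x \<pi>"
    by blast
qed

text \<open>The shape \<open>0 \<rightarrow> 2 \<leftarrow> 1\<close>: arrows \<open>0\<close>, \<open>1\<close>, \<open>2\<close> are the identities, \<open>3\<close> goes from \<open>0\<close> to \<open>2\<close> and \<open>4\<close> from
  \<open>1\<close> to \<open>2\<close>.\<close>

definition cospan :: "(nat, nat) cat" where
  "cospan = \<lparr>Obj = {0, 1, 2}, Arr = {0, 1, 2, 3, 4},
     Dom = (\<lambda>k. if k = 3 then 0 else if k = 4 then 1 else k),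
     Cod = (\<lambda>k. if k \<ge> 3 then 2 else k),
     Ident = (\<lambda>j. j), Comp = (\<lambda>k l. if k \<le> 2 then l else k)\<rparr>"

lemma finite_category_cospan: "finite_category cospan"
  unfolding finite_category_def category_def cospan_def Hom_def by auto

definition cospan_diagram :: "('o, 'm) cat \<Rightarrow> 'm \<Rightarrow> 'm \<Rightarrow> (nat, nat, 'o, 'm) func" where
  "cospan_diagram C f g =
     (let ob = (\<lambda>j. if j = 0 then Dom C f else if j = 1 then Dom C g else Cod C f)
      in \<lparr>FO = ob, FM = (\<lambda>k. if k = 3 then f else if k = 4 then g else Ident C (ob k))\<rparr>)"

lemma has_finite_limits_pullback:
  assumes "category C" and lim: "has_finite_limits C"
    and fg: "f \<in> Arr C" "g \<in> Arr C" "Cod C f = Cod C g"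
  shows "\<exists>p q. is_pullback C f g p q"
proof -
  interpret category C by fact
  let ?T = "cospan_diagram C f g"
  have "is_functor cospan C ?T"
    unfolding is_functor_def
    using finite_category_cospan category_axioms fg
    by (auto simp: finite_category_def cospan_def cospan_diagram_def Let_def Hom_def)
  then obtain x \<pi> where lim: "is_limit cospan C ?T x \<pi>"
    using lim finite_category_cospan unfolding has_finite_limits_def by blast
  have cone_iff: "is_cone cospan C ?T y \<mu> \<longleftrightarrow>
      \<mu> 0 \<in> Hom C y (Dom C f) \<and> \<mu> 1 \<in> Hom C y (Dom C g) \<and> \<mu> 2 = f \<cdot>\<^bsub>C\<^esub> \<mu> 0 \<and> \<mu> 2 = g \<cdot>\<^bsub>C\<^esub> \<mu> 1" for y \<mu>
    using fg by (auto simp: is_cone_def cospan_def cospan_diagram_def Let_def Hom_def)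
  have \<pi>: "\<pi> 0 \<in> Hom C x (Dom C f)" "\<pi> 1 \<in> Hom C x (Dom C g)" "\<pi> 2 = f \<cdot>\<^bsub>C\<^esub> \<pi> 0" "\<pi> 2 = g \<cdot>\<^bsub>C\<^esub> \<pi> 1"
    using lim unfolding is_limit_def cone_iff by blast+
  have "is_pullback C f g (\<pi> 0) (\<pi> 1)"
    unfolding is_pullback_def
  proof (intro conjI ballI impI, goal_cases)
    case (10 s t)
    let ?\<mu> = "\<lambda>j::nat. if j = 0 then s else if j = 1 then t else f \<cdot>\<^bsub>C\<^esub> s"
    have "is_cone cospan C ?T (Dom C s) ?\<mu>"
      unfolding cone_iff using 10 by (simp add: Hom_def)
    then have "\<exists>!u. u \<in> Hom C (Dom C s) x \<and> (\<forall>j \<in> Obj cospan. \<pi> j \<cdot>\<^bsub>C\<^esub> u = ?\<mu> j)"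
      using lim unfolding is_limit_def by blast
    moreover have "(\<forall>j \<in> Obj cospan. \<pi> j \<cdot>\<^bsub>C\<^esub> u = ?\<mu> j) \<longleftrightarrow> \<pi> 0 \<cdot>\<^bsub>C\<^esub> u = s \<and> \<pi> 1 \<cdot>\<^bsub>C\<^esub> u = t"
      if "u \<in> Hom C (Dom C s) x" for u
    proof -
      have "\<pi> 2 \<cdot>\<^bsub>C\<^esub> u = f \<cdot>\<^bsub>C\<^esub> (\<pi> 0 \<cdot>\<^bsub>C\<^esub> u)"
        using that \<pi>(1) fg unfolding \<pi>(3) by (intro assoc) (auto simp: Hom_def)
      then show ?thesis
        by (auto simp: cospan_def)
    qed
    moreover have "Dom C (\<pi> 0) = x"
      using \<pi> by (simp add: Hom_def)
    ultimately show ?case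
      by (simp cong: conj_cong)
  qed (use \<pi> fg in \<open>auto simp: Hom_def\<close>)
  then show ?thesis
    by blast
qed

section \<open>Small sets and the coding of finite tuples\<close>

lemma small_subset: "\<lbrakk>small B; A \<subseteq> B\<rbrakk> \<Longrightarrow> small A"
  unfolding small_def by (rule ordLeq_ordLess_trans[OF card_of_mono1])

lemma small_image: "small A \<Longrightarrow> small (g ` A)" for g :: "'u \<Rightarrow> 'u"
  unfolding small_def by (rule ordLeq_ordLess_trans[OF card_of_image])

text \<open>A set in the image of a presheaf consists of elements of \<open>'u\<close>, whereas a limit consists of tuples;
  a coding represents tuples inside \<open>'u\<close>. An injective pairing on the infinite type \<open>'u\<close> is iterated
  over \<open>I\<close>. Regularity of the universe keeps the codes of a product of small sets small.\<close>

lemma exists_tuple_coding: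
  fixes I :: "'j set"
  assumes U: "universe_type TYPE('u)" and "finite I"
  shows "\<exists>enc :: ('j \<Rightarrow> 'u) \<Rightarrow> 'u. inj_on enc (extensional I) \<and>
     (\<forall>A. (\<forall>i \<in> I. small (A i)) \<longrightarrow> small (enc ` PiE I A))"
proof -
  have inf: "infinite (UNIV :: 'u set)"
    and UN: "\<And>(A :: 'u set) (B :: 'u \<Rightarrow> 'u set). small A \<Longrightarrow> (\<And>a. a \<in> A \<Longrightarrow> small (B a)) \<Longrightarrow> small (\<Union>a \<in> A. B a)"
    using U unfolding universe_type_def by simp_all
  have "|(UNIV :: 'u set) \<times> (UNIV :: 'u set)| =o |UNIV :: 'u set|"
    by (rule card_of_Times_same_infinite[OF inf])
  then obtain p :: "'u \<times> 'u \<Rightarrow> 'u" where "bij_betw p (UNIV \<times> UNIV) UNIV"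
    unfolding card_of_ordIso[symmetric] by blast
  then have p: "p x = p y \<longleftrightarrow> x = y" for x y
    using inj_on_eq_iff[OF bij_betw_imp_inj_on, of p "UNIV \<times> UNIV" UNIV x y] by simp
  from \<open>finite I\<close> show ?thesis
  proof (induction I rule: finite_induct)
    case empty
    have "small {undefined :: 'u}"
      unfolding small_def by (rule finite_ordLess_infinite[OF card_of_Well_order card_of_Well_order]) (simp_all add: inf Field_card_of)
    then show ?case
      by (intro exI[of _ "\<lambda>_. undefined"]) (auto simp: inj_on_def)
  next
    case (insert i I)
    then obtain enc :: "('j \<Rightarrow> 'u) \<Rightarrow> 'u" where inj: "inj_on enc (extensional I)"
      and small: "\<And>A. (\<forall>i \<in> I. small (A i)) \<Longrightarrow> small (enc ` PiE I A)"
      by blast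
    \<comment> \<open>a tuple over \<open>insert i I\<close> is its \<open>i\<close>-th entry paired with the code of the rest\<close>
    let ?enc = "\<lambda>x. p (x i, enc (restrict x I))"
    have "inj_on ?enc (extensional (insert i I))"
    proof (rule inj_onI)
      fix x y assume x: "x \<in> extensional (insert i I)" and y: "y \<in> extensional (insert i I)" and "?enc x = ?enc y"
      then have "x i = y i" "restrict x I = restrict y I"
        using inj by (auto simp: p inj_on_def)
      then show "x = y"
        using x y by (intro extensionalityI[OF x y]) (metis insert_iff restrict_apply')
    qed
    moreover have "small (?enc ` PiE (insert i I) A)" if A: "\<forall>j \<in> insert i I. small (A j)" for A
    proof (rule small_subset)
      show "small (\<Union>a \<in> A i. (\<lambda>b. p (a, b)) ` enc ` PiE I A)"
        using A by (intro UN small_image small) simp_all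
      show "?enc ` PiE (insert i I) A \<subseteq> (\<Union>a \<in> A i. (\<lambda>b. p (a, b)) ` enc ` PiE I A)"
      proof clarify
        fix x assume x: "x \<in> PiE (insert i I) A"
        then have "x i \<in> A i" "restrict x I \<in> PiE I A"
          by (auto simp: PiE_iff)
        then show "?enc x \<in> (\<Union>a \<in> A i. (\<lambda>b. p (a, b)) ` enc ` PiE I A)"
          by blast
      qed
    qed
    ultimately show ?case
      by (intro exI[of _ ?enc]) blast
  qed
qed

section \<open>Presheaves and sheaves elementwise\<close>

lemma set_cat_simps [simp]:
  "Obj set_cat = {A. small A}"
  "Dom set_cat t = fst t"
  "Cod set_cat t = snd (snd t)"
  "Ident set_cat A = (A, (\<lambda>x \<in> A. x), A)"
  "fst (s \<cdot>\<^bsub>set_cat\<^esub> t) = fst t"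
  "snd (snd (s \<cdot>\<^bsub>set_cat\<^esub> t)) = snd (snd s)"
  by (simp_all add: set_cat_def)

lemma Arr_set_cat:
  "t \<in> Arr set_cat \<longleftrightarrow> small (fst t) \<and> small (snd (snd t)) \<and> app t \<in> fst t \<rightarrow>\<^sub>E snd (snd t)"
  by (cases t) (auto simp: set_cat_def app_def)

lemma app_simps [simp]:
  "app (A, g, B) = g"
  "x \<in> fst t \<Longrightarrow> app (s \<cdot>\<^bsub>set_cat\<^esub> t) x = app s (app t x)"
  by (simp_all add: app_def set_cat_def compose_def)

lemma app_Comp: "app (s \<cdot>\<^bsub>set_cat\<^esub> t) = compose (fst t) (app s) (app t)"
  by (simp add: app_def set_cat_def)

lemma set_cat_eqI:
  assumes "s \<in> Arr set_cat" "t \<in> Arr set_cat" "fst s = fst t" "snd (snd s) = snd (snd t)"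
    "\<And>x. x \<in> fst t \<Longrightarrow> app s x = app t x"
  shows "s = t"
proof -
  have "app s = app t"
    using assms by (intro extensionalityI[of _ "fst t"]) (auto simp: Arr_set_cat PiE_def)
  with assms show ?thesis
    by (simp add: app_def prod_eq_iff)
qed

lemma Comp_set_cat:
  assumes "t \<in> Arr set_cat" "s \<in> Arr set_cat" "snd (snd t) = fst s"
  shows "s \<cdot>\<^bsub>set_cat\<^esub> t \<in> Arr set_cat"
  using assms by (auto simp: Arr_set_cat app_Comp PiE_iff compose_def)

lemma category_set_cat: "category set_cat"
proof
  fix g h :: "'a smap" and A B D assume gh: "g \<in> Hom set_cat A B" "h \<in> Hom set_cat B D"
  then show hg: "h \<cdot>\<^bsub>set_cat\<^esub> g \<in> Hom set_cat A D"
    by (simp add: Hom_def Comp_set_cat)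
  fix k E assume k: "k \<in> Hom set_cat D E"
  show "(k \<cdot>\<^bsub>set_cat\<^esub> h) \<cdot>\<^bsub>set_cat\<^esub> g = k \<cdot>\<^bsub>set_cat\<^esub> h \<cdot>\<^bsub>set_cat\<^esub> g"
    using gh hg k
    by (intro set_cat_eqI) (auto simp: Hom_def Comp_set_cat Arr_set_cat[of g] PiE_iff)
qed (auto simp: Hom_def Arr_set_cat PiE_iff Comp_set_cat app_Comp compose_def intro!: set_cat_eqI)

lemma op_cat_simps [simp]:
  "Obj (op_cat C) = Obj C" "Arr (op_cat C) = Arr C" "Dom (op_cat C) = Cod C" "Cod (op_cat C) = Dom C"
  "Ident (op_cat C) = Ident C" "g \<cdot>\<^bsub>op_cat C\<^esub> f = f \<cdot>\<^bsub>C\<^esub> g"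
  by (simp_all add: op_cat_def)

lemma (in category) category_op_cat: "category (op_cat C)"
  by unfold_locales (auto simp: Hom_def)

lemma presheafD:
  assumes "is_presheaf C P"
  shows "c \<in> Obj C \<Longrightarrow> small (FO P c)"
    and "g \<in> Arr C \<Longrightarrow> FM P g \<in> Arr set_cat"
    and "g \<in> Arr C \<Longrightarrow> fst (FM P g) = FO P (Cod C g)"
    and "g \<in> Arr C \<Longrightarrow> snd (snd (FM P g)) = FO P (Dom C g)"
    and "c \<in> Obj C \<Longrightarrow> y \<in> FO P c \<Longrightarrow> app (FM P (Ident C c)) y = y"
    and "f \<in> Arr C \<Longrightarrow> g \<in> Arr C \<Longrightarrow> Cod C g = Dom C f \<Longrightarrow> y \<in> FO P (Cod C f) \<Longrightarrow>
      app (FM P (f \<cdot>\<^bsub>C\<^esub> g)) y = app (FM P g) (app (FM P f) y)"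
    and "g \<in> Arr C \<Longrightarrow> y \<in> FO P (Cod C g) \<Longrightarrow> app (FM P g) y \<in> FO P (Dom C g)"
  using assms
  by (auto simp: is_presheaf_def is_functor_def Hom_def Arr_set_cat PiE_iff)

lemma (in category) presheafI:
  assumes "\<And>c. c \<in> Obj C \<Longrightarrow> small (FO P c)"
    and "\<And>g. g \<in> Arr C \<Longrightarrow> FM P g \<in> Arr set_cat \<and> fst (FM P g) = FO P (Cod C g) \<and> snd (snd (FM P g)) = FO P (Dom C g)"
    and "\<And>c y. c \<in> Obj C \<Longrightarrow> y \<in> FO P c \<Longrightarrow> app (FM P (Ident C c)) y = y"
    and "\<And>f g y. f \<in> Arr C \<Longrightarrow> g \<in> Arr C \<Longrightarrow> Cod C g = Dom C f \<Longrightarrow> y \<in> FO P (Cod C f) \<Longrightarrow>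
      app (FM P (f \<cdot> g)) y = app (FM P g) (app (FM P f) y)"
  shows "is_presheaf C P"
  unfolding is_presheaf_def is_functor_def
proof (intro conjI ballI impI)
  fix c assume c: "c \<in> Obj (op_cat C)"
  then have "Ident set_cat (FO P c) \<in> Arr set_cat"
    using assms(1) by (auto simp: Arr_set_cat)
  then show "FM P (Ident (op_cat C) c) = Ident set_cat (FO P c)"
    using c assms(2)[of "Ident C c"] assms(3) by (intro set_cat_eqI) simp_all
next
  fix f g assume fg: "f \<in> Arr (op_cat C)" "g \<in> Arr (op_cat C)" "Cod (op_cat C) f = Dom (op_cat C) g"
  then show "FM P (g \<cdot>\<^bsub>op_cat C\<^esub> f) = FM P g \<cdot>\<^bsub>set_cat\<^esub> FM P f"
    using assms(2)[of f] assms(2)[of g] assms(2)[of "f \<cdot> g"] assms(4)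
    by (intro set_cat_eqI Comp_set_cat) simp_all
qed (use assms category_op_cat category_set_cat in \<open>simp_all add: Hom_def\<close>)

text \<open>The effect of a component of a map of sheaves on elements.\<close>

definition act :: "'x \<times> ('o \<Rightarrow> 'u smap) \<times> 'x \<Rightarrow> 'o \<Rightarrow> 'u \<Rightarrow> 'u" where
  "act a c = app (fst (snd a) c)"

text \<open>Components and the functions inside them are cut down to their domains, as arrows of \<open>sheaf_cat\<close>
  and \<open>set_cat\<close> require; an arrow is then determined by its action on elements.\<close>

definition sheaf_map :: "('o, 'm) cat \<Rightarrow> ('o, 'm, 'u) presheaf \<Rightarrow> ('o \<Rightarrow> 'u \<Rightarrow> 'u) \<Rightarrow> ('o, 'm, 'u) presheaf \<Rightarrow>
    ('o, 'm, 'u) presheaf \<times> ('o \<Rightarrow> 'u smap) \<times> ('o, 'm, 'u) presheaf" where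
  "sheaf_map C P \<phi> Q = (P, (\<lambda>c \<in> Obj C. (FO P c, restrict (\<phi> c) (FO P c), FO Q c)), Q)"

lemma sheaf_map_simps [simp]:
  "fst (sheaf_map C P \<phi> Q) = P" "snd (snd (sheaf_map C P \<phi> Q)) = Q"
  "c \<in> Obj C \<Longrightarrow> y \<in> FO P c \<Longrightarrow> act (sheaf_map C P \<phi> Q) c y = \<phi> c y"
  by (simp_all add: sheaf_map_def act_def)

lemma sheaf_cat_simps [simp]:
  "Obj (sheaf_cat C K) = {P. is_sheaf C K P}"
  "Dom (sheaf_cat C K) a = fst a"
  "Cod (sheaf_cat C K) a = snd (snd a)"
  by (simp_all add: sheaf_cat_def)

lemma Arr_sheaf_catD:
  assumes "a \<in> Arr (sheaf_cat C K)"
  shows "is_sheaf C K (fst a)" "is_sheaf C K (snd (snd a))"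
    and "c \<in> Obj C \<Longrightarrow> fst (snd a) c \<in> Arr set_cat"
    and "c \<in> Obj C \<Longrightarrow> fst (fst (snd a) c) = FO (fst a) c"
    and "c \<in> Obj C \<Longrightarrow> snd (snd (fst (snd a) c)) = FO (snd (snd a)) c"
    and "c \<in> Obj C \<Longrightarrow> y \<in> FO (fst a) c \<Longrightarrow> act a c y \<in> FO (snd (snd a)) c"
    and "g \<in> Arr C \<Longrightarrow> y \<in> FO (fst a) (Cod C g) \<Longrightarrow> Cod C g \<in> Obj C \<Longrightarrow>
      act a (Dom C g) (app (FM (fst a) g) y) = app (FM (snd (snd a)) g) (act a (Cod C g) y)"
    and "fst (snd a) \<in> extensional (Obj C)"
proof -
  obtain P \<alpha> Q where a: "a = (P, \<alpha>, Q)" "is_sheaf C K P" "is_sheaf C K Q"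
    "nat_trans (op_cat C) set_cat P Q \<alpha>" "\<alpha> \<in> extensional (Obj C)"
    using assms by (auto simp: sheaf_cat_def)
  then show "is_sheaf C K (fst a)" "is_sheaf C K (snd (snd a))" "fst (snd a) \<in> extensional (Obj C)"
    by simp_all
  have \<alpha>: "\<alpha> c \<in> Arr set_cat" "fst (\<alpha> c) = FO P c" "snd (snd (\<alpha> c)) = FO Q c" if "c \<in> Obj C" for c
    using a(4) that by (auto simp: nat_trans_def Hom_def)
  have nat: "\<alpha> (Dom C g) \<cdot>\<^bsub>set_cat\<^esub> FM P g = FM Q g \<cdot>\<^bsub>set_cat\<^esub> \<alpha> (Cod C g)" if "g \<in> Arr C" for g
    using a(4) that by (auto simp: nat_trans_def)
  have FMP: "fst (FM P g) = FO P (Cod C g)" if "g \<in> Arr C" for g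
    using a(4) that by (auto simp: nat_trans_def is_functor_def Hom_def)
  show "c \<in> Obj C \<Longrightarrow> fst (snd a) c \<in> Arr set_cat" "c \<in> Obj C \<Longrightarrow> fst (fst (snd a) c) = FO (fst a) c"
    "c \<in> Obj C \<Longrightarrow> snd (snd (fst (snd a) c)) = FO (snd (snd a)) c"
    "c \<in> Obj C \<Longrightarrow> y \<in> FO (fst a) c \<Longrightarrow> act a c y \<in> FO (snd (snd a)) c"
    using \<alpha> by (auto simp: a(1) act_def Arr_set_cat PiE_iff)
  show "act a (Dom C g) (app (FM (fst a) g) y) = app (FM (snd (snd a)) g) (act a (Cod C g) y)"
    if "g \<in> Arr C" "y \<in> FO (fst a) (Cod C g)" "Cod C g \<in> Obj C"
    using that nat[OF that(1)] \<alpha>(2)[of "Cod C g"] FMP[of g] app_simps(2)[of y "FM P g" "\<alpha> (Dom C g)"]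
      app_simps(2)[of y "\<alpha> (Cod C g)" "FM Q g"]
    by (simp add: a(1) act_def)
qed

lemma Arr_sheaf_cat_eqI:
  assumes a: "a \<in> Arr (sheaf_cat C K)" and b: "b \<in> Arr (sheaf_cat C K)"
    and "fst a = fst b" "snd (snd a) = snd (snd b)"
    and eq: "\<And>c y. c \<in> Obj C \<Longrightarrow> y \<in> FO (fst a) c \<Longrightarrow> act a c y = act b c y"
  shows "a = b"
proof -
  note A = Arr_sheaf_catD[OF a] and B = Arr_sheaf_catD[OF b]
  have "fst (snd a) c = fst (snd b) c" if c: "c \<in> Obj C" for c
    using A(3-5)[OF c] B(3-5)[OF c] eq[OF c] assms(3,4) by (intro set_cat_eqI) (simp_all add: act_def)
  then have "fst (snd a) = fst (snd b)"
    using A(8) B(8) by (intro extensionalityI)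
  with assms(3,4) show ?thesis
    by (simp add: prod_eq_iff)
qed

lemma act_Comp:
  assumes "a \<in> Arr (sheaf_cat C K)" "c \<in> Obj C" "y \<in> FO (fst a) c"
  shows "act (b \<cdot>\<^bsub>sheaf_cat C K\<^esub> a) c y = act b c (act a c y)"
  using assms Arr_sheaf_catD(4)[OF assms(1,2)] by (simp add: act_def sheaf_cat_def)

lemma (in category) sheaf_map_Arr:
  assumes P: "is_sheaf C K P" and Q: "is_sheaf C K Q"
    and maps: "\<And>c y. c \<in> Obj C \<Longrightarrow> y \<in> FO P c \<Longrightarrow> \<phi> c y \<in> FO Q c"
    and nat: "\<And>g y. g \<in> Arr C \<Longrightarrow> y \<in> FO P (Cod C g) \<Longrightarrow>
      \<phi> (Dom C g) (app (FM P g) y) = app (FM Q g) (\<phi> (Cod C g) y)"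
  shows "sheaf_map C P \<phi> Q \<in> Arr (sheaf_cat C K)"
proof -
  have P': "is_presheaf C P" and Q': "is_presheaf C Q"
    using P Q by (simp_all add: is_sheaf_def)
  note p = presheafD[OF P'] and q = presheafD[OF Q']
  let ?\<alpha> = "\<lambda>c. (FO P c, restrict (\<phi> c) (FO P c), FO Q c)"
  have \<alpha>: "?\<alpha> c \<in> Arr set_cat" if "c \<in> Obj C" for c
    using that maps p(1) q(1) by (auto simp: Arr_set_cat)
  have "?\<alpha> (Dom C g) \<cdot>\<^bsub>set_cat\<^esub> FM P g = FM Q g \<cdot>\<^bsub>set_cat\<^esub> ?\<alpha> (Cod C g)" if g: "g \<in> Arr C" for g
    using g \<alpha> nat p(2-4,7) q(2-4)
    by (intro set_cat_eqI Comp_set_cat) simp_all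
  then have "nat_trans (op_cat C) set_cat P Q (restrict ?\<alpha> (Obj C))"
    using \<alpha> P' Q' by (auto simp: nat_trans_def is_presheaf_def Hom_def)
  then show ?thesis
    using P Q by (simp add: sheaf_cat_def sheaf_map_def)
qed

section \<open>Finite limits of sheaves\<close>

text \<open>The limit is formed pointwise: over \<open>c\<close> it consists of the codes of the compatible families of
  elements of the sets \<open>FO (FO T j) c\<close>, and restriction acts entry by entry.\<close>

locale finite_sheaf_diagram = C: category C
  for C :: "('o, 'm) cat" and K :: "'o \<Rightarrow> 'm set set"
    and J :: "(nat, nat) cat"
    and T :: "(nat, nat, ('o, 'm, 'u) presheaf,
      ('o, 'm, 'u) presheaf \<times> ('o \<Rightarrow> 'u smap) \<times> ('o, 'm, 'u) presheaf) func"
    and enc :: "(nat \<Rightarrow> 'u) \<Rightarrow> 'u" +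
  assumes topology: "grothendieck_topology C K"
    and diagram: "is_functor J (sheaf_cat C K) T"
    and enc_inj: "inj_on enc (extensional (Obj J))"
    and enc_small: "(\<forall>j \<in> Obj J. small (A j)) \<Longrightarrow> small (enc ` PiE (Obj J) A)"
begin

sublocale T: functor_between J "sheaf_cat C K" T
  by (rule functor_betweenI[OF diagram])

definition dec :: "'u \<Rightarrow> nat \<Rightarrow> 'u" where
  "dec = inv_into (extensional (Obj J)) enc"

lemma dec_enc [simp]: "x \<in> extensional (Obj J) \<Longrightarrow> dec (enc x) = x"
  unfolding dec_def using enc_inj by (rule inv_into_f_f)

definition families :: "'o \<Rightarrow> (nat \<Rightarrow> 'u) set" where
  "families c = {x \<in> (\<Pi>\<^sub>E j \<in> Obj J. FO (FO T j) c).
     \<forall>k \<in> Arr J. act (FM T k) c (x (Dom J k)) = x (Cod J k)}"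

definition limit_sheaf :: "('o, 'm, 'u) presheaf" where
  "limit_sheaf = \<lparr>FO = (\<lambda>c. enc ` families c),
     FM = (\<lambda>g. (enc ` families (Cod C g),
       (\<lambda>y \<in> enc ` families (Cod C g). enc (\<lambda>j \<in> Obj J. app (FM (FO T j) g) (dec y j))),
       enc ` families (Dom C g)))\<rparr>"

lemma sheaf_T: "j \<in> Obj J \<Longrightarrow> is_sheaf C K (FO T j)"
  using T.FO_Obj by simp

lemma presheaf_T: "j \<in> Obj J \<Longrightarrow> is_presheaf C (FO T j)"
  using sheaf_T by (simp add: is_sheaf_def)

lemma FM_T:
  assumes "k \<in> Arr J"
  shows "FM T k \<in> Arr (sheaf_cat C K)" "fst (FM T k) = FO T (Dom J k)" "snd (snd (FM T k)) = FO T (Cod J k)"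
  using assms T.Dom_FM[of k] T.Cod_FM[of k] by simp_all

lemma familiesD:
  assumes "x \<in> families c"
  shows "x \<in> extensional (Obj J)" "j \<in> Obj J \<Longrightarrow> x j \<in> FO (FO T j) c"
    "k \<in> Arr J \<Longrightarrow> act (FM T k) c (x (Dom J k)) = x (Cod J k)"
  using assms by (auto simp: families_def PiE_iff)

lemma familiesI:
  assumes "\<And>j. j \<in> Obj J \<Longrightarrow> x j \<in> FO (FO T j) c"
    "\<And>k. k \<in> Arr J \<Longrightarrow> act (FM T k) c (x (Dom J k)) = x (Cod J k)"
  shows "restrict x (Obj J) \<in> families c"
  using assms by (auto simp: families_def)

lemma FO_limit_sheaf: "FO limit_sheaf c = enc ` families c"
  by (simp add: limit_sheaf_def)

lemma limit_sheafD:
  assumes "y \<in> FO limit_sheaf c"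
  shows "enc (dec y) = y" "dec y \<in> families c"
  using assms familiesD(1) by (auto simp: FO_limit_sheaf)

lemma limit_sheaf_eqI:
  assumes "y \<in> FO limit_sheaf c" "z \<in> FO limit_sheaf c'" "\<And>j. j \<in> Obj J \<Longrightarrow> dec y j = dec z j"
  shows "y = z"
proof -
  have "dec y = dec z"
    using assms familiesD(1) limit_sheafD(2) by (intro extensionalityI[of _ "Obj J"]) blast+
  then show ?thesis
    using assms(1,2) by (metis limit_sheafD(1))
qed

lemma restrict_family:
  assumes "g \<in> Arr C" "x \<in> families (Cod C g)"
  shows "(\<lambda>j \<in> Obj J. app (FM (FO T j) g) (x j)) \<in> families (Dom C g)"
proof (rule familiesI)
  fix j assume "j \<in> Obj J"
  then show "app (FM (FO T j) g) (x j) \<in> FO (FO T j) (Dom C g)"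
    using assms presheafD(7)[OF presheaf_T] familiesD(2) by blast
next
  fix k assume k: "k \<in> Arr J"
  then show "act (FM T k) (Dom C g) (app (FM (FO T (Dom J k)) g) (x (Dom J k)))
      = app (FM (FO T (Cod J k)) g) (x (Cod J k))"
    using assms Arr_sheaf_catD(7)[OF FM_T(1)[OF k] assms(1)] FM_T[OF k] familiesD[OF assms(2)] by simp
qed

lemma app_limit_sheaf:
  assumes "g \<in> Arr C" "y \<in> FO limit_sheaf (Cod C g)"
  shows "app (FM limit_sheaf g) y \<in> FO limit_sheaf (Dom C g)"
    and "j \<in> Obj J \<Longrightarrow> dec (app (FM limit_sheaf g) y) j = app (FM (FO T j) g) (dec y j)"
proof -
  let ?x = "\<lambda>j \<in> Obj J. app (FM (FO T j) g) (dec y j)"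
  have "app (FM limit_sheaf g) y = enc ?x"
    using assms by (simp add: limit_sheaf_def)
  moreover have "?x \<in> families (Dom C g)"
    using assms by (intro restrict_family limit_sheafD)
  ultimately show "app (FM limit_sheaf g) y \<in> FO limit_sheaf (Dom C g)"
    "j \<in> Obj J \<Longrightarrow> dec (app (FM limit_sheaf g) y) j = app (FM (FO T j) g) (dec y j)"
    by (simp_all add: FO_limit_sheaf)
qed

lemma dec_limit_sheaf: "\<lbrakk>y \<in> FO limit_sheaf c; j \<in> Obj J\<rbrakk> \<Longrightarrow> dec y j \<in> FO (FO T j) c"
  by (rule familiesD(2)[OF limit_sheafD(2)])

lemma presheaf_limit: "is_presheaf C limit_sheaf"
proof (rule C.presheafI)
  have small: "small (FO limit_sheaf c)" if "c \<in> Obj C" for c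
  proof (rule small_subset)
    show "small (enc ` (\<Pi>\<^sub>E j \<in> Obj J. FO (FO T j) c))"
      using that presheafD(1)[OF presheaf_T] by (intro enc_small) blast
    show "FO limit_sheaf c \<subseteq> enc ` (\<Pi>\<^sub>E j \<in> Obj J. FO (FO T j) c)"
      by (auto simp: FO_limit_sheaf families_def)
  qed
  then show "small (FO limit_sheaf c)" if "c \<in> Obj C" for c
    using that .
  show "FM limit_sheaf g \<in> Arr set_cat \<and> fst (FM limit_sheaf g) = FO limit_sheaf (Cod C g) \<and>
      snd (snd (FM limit_sheaf g)) = FO limit_sheaf (Dom C g)" if g: "g \<in> Arr C" for g
  proof -
    have "app (FM limit_sheaf g) \<in> FO limit_sheaf (Cod C g) \<rightarrow>\<^sub>E FO limit_sheaf (Dom C g)"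
      using app_limit_sheaf(1)[OF g] by (auto simp: PiE_iff) (simp add: limit_sheaf_def)
    moreover have "fst (FM limit_sheaf g) = FO limit_sheaf (Cod C g)" "snd (snd (FM limit_sheaf g)) = FO limit_sheaf (Dom C g)"
      by (simp_all add: limit_sheaf_def)
    ultimately show ?thesis
      using small g by (simp add: Arr_set_cat)
  qed
  show "app (FM limit_sheaf (Ident C c)) y = y" if "c \<in> Obj C" "y \<in> FO limit_sheaf c" for c y
    using that app_limit_sheaf[of "Ident C c" y] dec_limit_sheaf[of y c] presheafD(5)[OF presheaf_T]
    by - (rule limit_sheaf_eqI[of _ c _ c]; simp)
  show "app (FM limit_sheaf (f \<cdot>\<^bsub>C\<^esub> g)) y = app (FM limit_sheaf g) (app (FM limit_sheaf f) y)"
    if "f \<in> Arr C" "g \<in> Arr C" "Cod C g = Dom C f" "y \<in> FO limit_sheaf (Cod C f)" for f g y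
    using that app_limit_sheaf[of "f \<cdot>\<^bsub>C\<^esub> g" y] app_limit_sheaf[of f y]
      app_limit_sheaf[of g "app (FM limit_sheaf f) y"] dec_limit_sheaf[of y "Cod C f"] presheafD(6)[OF presheaf_T]
    by - (rule limit_sheaf_eqI[of _ "Dom C g" _ "Dom C g"]; simp)
qed

text \<open>A matching family of compatible families is amalgamated entry by entry. The amalgams are again
  compatible: both sides of a compatibility equation are amalgams of the same matching family,
  and sheaves have unique amalgams.\<close>

lemma sheaf_limit: "is_sheaf C K limit_sheaf"
  unfolding is_sheaf_def
proof (intro conjI presheaf_limit ballI allI impI)
  fix c S y
  assume c: "c \<in> Obj C" and S: "S \<in> K c" and y: "matching_family C limit_sheaf S y"
  have "is_sieve C c S"
    using topology c S by (auto simp: grothendieck_topology_def)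
  then have S_arr: "f \<in> Arr C" "Cod C f = c" if "f \<in> S" for f
    using that by (auto simp: is_sieve_def)
  have S_comp: "f \<cdot>\<^bsub>C\<^esub> g \<in> S" if "f \<in> S" "g \<in> Arr C" "Cod C g = Dom C f" for f g
    using that \<open>is_sieve C c S\<close> by (auto simp: is_sieve_def)
  have y_in: "y f \<in> FO limit_sheaf (Dom C f)" if "f \<in> S" for f
    using y that by (auto simp: matching_family_def)
  have y_comp: "app (FM limit_sheaf g) (y f) = y (f \<cdot>\<^bsub>C\<^esub> g)" if "f \<in> S" "g \<in> Arr C" "Cod C g = Dom C f" for f g
    using y that by (auto simp: matching_family_def)
  have ex1: "\<exists>!z. z \<in> FO (FO T j) c \<and> (\<forall>f \<in> S. app (FM (FO T j) f) z = dec (y f) j)"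
    if j: "j \<in> Obj J" for j
  proof -
    have "matching_family C (FO T j) S (\<lambda>f. dec (y f) j)"
      unfolding matching_family_def
    proof (intro conjI ballI impI)
      fix f assume f: "f \<in> S"
      then show "dec (y f) j \<in> FO (FO T j) (Dom C f)"
        using y_in j by (intro dec_limit_sheaf)
      fix g assume g: "g \<in> Arr C" "Cod C g = Dom C f"
      then show "app (FM (FO T j) g) (dec (y f) j) = dec (y (f \<cdot>\<^bsub>C\<^esub> g)) j"
        using f j y_in[of f] app_limit_sheaf(2)[of g "y f" j] by (simp flip: y_comp)
    qed
    then show ?thesis
      using sheaf_T[OF j] c S by (auto simp: is_sheaf_def)
  qed
  have unique: "a = b" if "j \<in> Obj J" "a \<in> FO (FO T j) c" "\<And>f. f \<in> S \<Longrightarrow> app (FM (FO T j) f) a = dec (y f) j"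
    "b \<in> FO (FO T j) c" "\<And>f. f \<in> S \<Longrightarrow> app (FM (FO T j) f) b = dec (y f) j" for j a b
    using ex1[OF that(1)] that by blast
  from ex1 obtain z where z: "\<And>j. j \<in> Obj J \<Longrightarrow> z j \<in> FO (FO T j) c"
    "\<And>j f. j \<in> Obj J \<Longrightarrow> f \<in> S \<Longrightarrow> app (FM (FO T j) f) (z j) = dec (y f) j"
    by metis
  have z_family: "restrict z (Obj J) \<in> families c"
  proof (rule familiesI)
    fix k assume k: "k \<in> Arr J"
    note a = Arr_sheaf_catD[OF FM_T(1)[OF k], unfolded FM_T(2,3)[OF k]]
    have "act (FM T k) c (z (Dom J k)) \<in> FO (FO T (Cod J k)) c"
      using a(6)[OF c] z(1) k by simp
    moreover have "app (FM (FO T (Cod J k)) f) (act (FM T k) c (z (Dom J k))) = dec (y f) (Cod J k)" if f: "f \<in> S" for f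
    proof -
      have "app (FM (FO T (Cod J k)) f) (act (FM T k) c (z (Dom J k))) = act (FM T k) (Dom C f) (dec (y f) (Dom J k))"
        using a(7)[OF S_arr(1)[OF f], of "z (Dom J k)"] S_arr[OF f] c z[of "Dom J k"] k f by simp
      also have "\<dots> = dec (y f) (Cod J k)"
        by (rule familiesD(3)[OF limit_sheafD(2)[OF y_in[OF f]] k])
      finally show ?thesis .
    qed
    ultimately show "act (FM T k) c (z (Dom J k)) = z (Cod J k)"
      using k z[of "Cod J k"] by - (rule unique[of "Cod J k"]; simp)
  qed (rule z(1))
  let ?w = "enc (restrict z (Obj J))"
  have dec_w: "dec ?w j = z j" if "j \<in> Obj J" for j
    using z_family that familiesD(1) by simp
  have w: "?w \<in> FO limit_sheaf c"
    using z_family by (simp add: FO_limit_sheaf)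
  show "\<exists>!w. w \<in> FO limit_sheaf c \<and> (\<forall>f \<in> S. app (FM limit_sheaf f) w = y f)"
  proof (rule ex1I[of _ ?w])
    have "app (FM limit_sheaf f) ?w = y f" if f: "f \<in> S" for f
      using app_limit_sheaf[of f ?w] S_arr[OF f] w y_in[OF f] z(2) f dec_w
      by - (rule limit_sheaf_eqI[of _ "Dom C f" _ "Dom C f"]; simp)
    then show "?w \<in> FO limit_sheaf c \<and> (\<forall>f \<in> S. app (FM limit_sheaf f) ?w = y f)"
      using w by simp
  next
    fix v assume v: "v \<in> FO limit_sheaf c \<and> (\<forall>f \<in> S. app (FM limit_sheaf f) v = y f)"
    show "v = ?w"
    proof (rule limit_sheaf_eqI[of _ c _ c])
      fix j assume j: "j \<in> Obj J"
      have "app (FM (FO T j) f) (dec v j) = dec (y f) j" if f: "f \<in> S" for f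
        using v f j S_arr[OF f] app_limit_sheaf(2)[of f v j] by simp
      moreover have "dec v j \<in> FO (FO T j) c"
        using v j by (intro dec_limit_sheaf) simp_all
      ultimately have "dec v j = z j"
        using z[OF j] by - (rule unique[OF j]; simp)
      then show "dec v j = dec ?w j"
        using dec_w[OF j] by simp
    qed (use v w in simp_all)
  qed
qed

definition projection ::
    "nat \<Rightarrow> ('o, 'm, 'u) presheaf \<times> ('o \<Rightarrow> 'u smap) \<times> ('o, 'm, 'u) presheaf" where
  "projection j = sheaf_map C limit_sheaf (\<lambda>c y. dec y j) (FO T j)"

lemma projection:
  assumes "j \<in> Obj J"
  shows "projection j \<in> Arr (sheaf_cat C K)" "fst (projection j) = limit_sheaf" "snd (snd (projection j)) = FO T j"
    and "\<lbrakk>c \<in> Obj C; y \<in> FO limit_sheaf c\<rbrakk> \<Longrightarrow> act (projection j) c y = dec y j"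
  unfolding projection_def
  using assms dec_limit_sheaf app_limit_sheaf(2)
  by (auto intro!: C.sheaf_map_Arr sheaf_limit sheaf_T)

lemma limit: "is_limit J (sheaf_cat C K) T limit_sheaf projection"
proof -
  have "is_cone J (sheaf_cat C K) T limit_sheaf projection"
  proof (rule is_coneI)
    fix k assume k: "k \<in> Arr J"
    note p = projection[of "Dom J k"] and q = projection[of "Cod J k"] and a = FM_T[OF k]
    have comp: "FM T k \<cdot>\<^bsub>sheaf_cat C K\<^esub> projection (Dom J k) \<in> Arr (sheaf_cat C K)"
      "fst (FM T k \<cdot>\<^bsub>sheaf_cat C K\<^esub> projection (Dom J k)) = limit_sheaf"
      "snd (snd (FM T k \<cdot>\<^bsub>sheaf_cat C K\<^esub> projection (Dom J k))) = FO T (Cod J k)"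
      using k p(1-3) a T.D.Comp_Arr[of "projection (Dom J k)" "FM T k"]
        T.D.Dom_Comp[of "projection (Dom J k)" "FM T k"] T.D.Cod_Comp[of "projection (Dom J k)" "FM T k"]
      by simp_all
    show "FM T k \<cdot>\<^bsub>sheaf_cat C K\<^esub> projection (Dom J k) = projection (Cod J k)"
    proof (rule Arr_sheaf_cat_eqI)
      fix c y assume "c \<in> Obj C" "y \<in> FO (fst (FM T k \<cdot>\<^bsub>sheaf_cat C K\<^esub> projection (Dom J k))) c"
      then show "act (FM T k \<cdot>\<^bsub>sheaf_cat C K\<^esub> projection (Dom J k)) c y = act (projection (Cod J k)) c y"
        using k p q comp familiesD(3)[OF limit_sheafD(2), of y c k] by (simp add: act_Comp)
    qed (use k q comp in simp_all)
  qed (use sheaf_limit projection in simp_all)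
  moreover have "\<exists>!u. u \<in> Hom (sheaf_cat C K) Q limit_sheaf \<and>
      (\<forall>j \<in> Obj J. projection j \<cdot>\<^bsub>sheaf_cat C K\<^esub> u = \<mu> j)"
    if "is_cone J (sheaf_cat C K) T Q \<mu>" for Q \<mu>
  proof -
    note m = is_coneD[OF that, simplified]
    have \<mu>_act: "act (\<mu> j) c y \<in> FO (FO T j) c" if "j \<in> Obj J" "c \<in> Obj C" "y \<in> FO Q c" for j c y
      using that Arr_sheaf_catD(6)[OF m(2), of j c y] m(3,4) by simp
    let ?x = "\<lambda>c y. \<lambda>j \<in> Obj J. act (\<mu> j) c y"
    have x: "?x c y \<in> families c" if "c \<in> Obj C" "y \<in> FO Q c" for c y
    proof (rule familiesI)
      fix k assume k: "k \<in> Arr J"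
      then have "act (FM T k) c (act (\<mu> (Dom J k)) c y) = act (FM T k \<cdot>\<^bsub>sheaf_cat C K\<^esub> \<mu> (Dom J k)) c y"
        using that m(2,3)[of "Dom J k"] by (simp add: act_Comp)
      then show "act (FM T k) c (act (\<mu> (Dom J k)) c y) = act (\<mu> (Cod J k)) c y"
        using m(5)[OF k] by simp
    qed (use \<mu>_act that in blast)
    let ?u = "sheaf_map C Q (\<lambda>c y. enc (?x c y)) limit_sheaf"
    have u: "?u \<in> Arr (sheaf_cat C K)"
    proof (rule C.sheaf_map_Arr)
      fix g y assume g: "g \<in> Arr C" and y: "y \<in> FO Q (Cod C g)"
      have w: "enc (?x (Cod C g) y) \<in> FO limit_sheaf (Cod C g)"
        using x g y by (simp add: FO_limit_sheaf)
      have gy: "app (FM Q g) y \<in> FO Q (Dom C g)"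
        using m(1) g y by (auto simp: is_sheaf_def intro: presheafD(7))
      then have "enc (?x (Dom C g) (app (FM Q g) y)) \<in> FO limit_sheaf (Dom C g)"
        using x g by (simp add: FO_limit_sheaf)
      moreover have "act (\<mu> j) (Dom C g) (app (FM Q g) y) = app (FM (FO T j) g) (act (\<mu> j) (Cod C g) y)"
        if j: "j \<in> Obj J" for j
        using Arr_sheaf_catD(7)[OF m(2)[OF j] g] g y m(3,4)[OF j] by simp
      ultimately show "enc (?x (Dom C g) (app (FM Q g) y)) = app (FM limit_sheaf g) (enc (?x (Cod C g) y))"
        using app_limit_sheaf[OF g w] by - (rule limit_sheaf_eqI[of _ "Dom C g" _ "Dom C g"]; simp)
    qed (use m(1) sheaf_limit x in \<open>simp_all add: FO_limit_sheaf\<close>)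
    have proj_comp: "projection j \<cdot>\<^bsub>sheaf_cat C K\<^esub> v \<in> Arr (sheaf_cat C K)"
      "fst (projection j \<cdot>\<^bsub>sheaf_cat C K\<^esub> v) = Q" "snd (snd (projection j \<cdot>\<^bsub>sheaf_cat C K\<^esub> v)) = FO T j"
      "\<And>c y. c \<in> Obj C \<Longrightarrow> y \<in> FO Q c \<Longrightarrow> act (projection j \<cdot>\<^bsub>sheaf_cat C K\<^esub> v) c y = dec (act v c y) j"
      if j: "j \<in> Obj J" and v: "v \<in> Arr (sheaf_cat C K)" "fst v = Q" "snd (snd v) = limit_sheaf" for j v
      using v projection[OF j] T.D.Comp_Arr[of v "projection j"] T.D.Dom_Comp[of v "projection j"]
        T.D.Cod_Comp[of v "projection j"] Arr_sheaf_catD(6)[OF v(1)]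
      by (simp_all add: act_Comp)
    show ?thesis
    proof (rule ex1I[of _ ?u])
      have "projection j \<cdot>\<^bsub>sheaf_cat C K\<^esub> ?u = \<mu> j" if j: "j \<in> Obj J" for j
        using proj_comp[OF j u] m(2-4)[OF j] x j by (intro Arr_sheaf_cat_eqI) simp_all
      then show "?u \<in> Hom (sheaf_cat C K) Q limit_sheaf \<and>
          (\<forall>j \<in> Obj J. projection j \<cdot>\<^bsub>sheaf_cat C K\<^esub> ?u = \<mu> j)"
        using u by (simp add: Hom_def)
    next
      fix v assume "v \<in> Hom (sheaf_cat C K) Q limit_sheaf \<and>
        (\<forall>j \<in> Obj J. projection j \<cdot>\<^bsub>sheaf_cat C K\<^esub> v = \<mu> j)"
      then have v: "v \<in> Arr (sheaf_cat C K)" "fst v = Q" "snd (snd v) = limit_sheaf"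
        and v\<mu>: "\<And>j. j \<in> Obj J \<Longrightarrow> projection j \<cdot>\<^bsub>sheaf_cat C K\<^esub> v = \<mu> j"
        by (simp_all add: Hom_def)
      show "v = ?u"
      proof (rule Arr_sheaf_cat_eqI)
        fix c y assume c: "c \<in> Obj C" and "y \<in> FO (fst v) c"
        then have y: "y \<in> FO Q c"
          using v by simp
        have "act v c y \<in> FO limit_sheaf c" "enc (?x c y) \<in> FO limit_sheaf c"
          using Arr_sheaf_catD(6)[OF v(1) c] v y x[OF c y] by (simp_all add: FO_limit_sheaf)
        moreover have "dec (act v c y) j = act (\<mu> j) c y" if "j \<in> Obj J" for j
          using proj_comp(4)[OF that v c y] v\<mu>[OF that] by simp
        ultimately have "act v c y = enc (?x c y)"
          by - (rule limit_sheaf_eqI[of _ c _ c]; simp)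
        then show "act v c y = act ?u c y"
          using c y by simp
      qed (use u v in simp_all)
    qed
  qed
  ultimately show ?thesis
    unfolding is_limit_def by blast
qed

end

lemma sheaf_cat_has_finite_limits:
  fixes C :: "('o, 'm) cat"
  assumes U: "universe_type TYPE('u)" and C: "category C" and K: "grothendieck_topology C K"
  shows "has_finite_limits (sheaf_cat C K :: (('o, 'm, 'u) presheaf,
    ('o, 'm, 'u) presheaf \<times> ('o \<Rightarrow> 'u smap) \<times> ('o, 'm, 'u) presheaf) cat)"
  unfolding has_finite_limits_def
proof (intro allI impI, elim conjE)
  fix J and T :: "(nat, nat, ('o, 'm, 'u) presheaf,
    ('o, 'm, 'u) presheaf \<times> ('o \<Rightarrow> 'u smap) \<times> ('o, 'm, 'u) presheaf) func"
  assume J: "finite_category J" and T: "is_functor J (sheaf_cat C K) T"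
  from J have "finite (Obj J)"
    by (simp add: finite_category_def)
  from exists_tuple_coding[OF U this] obtain enc :: "(nat \<Rightarrow> 'u) \<Rightarrow> 'u"
    where "inj_on enc (extensional (Obj J))"
      "\<And>A. (\<forall>j \<in> Obj J. small (A j)) \<Longrightarrow> small (enc ` PiE (Obj J) A)"
    by blast
  then have "finite_sheaf_diagram C K J T enc"
    using C K T by (auto simp: finite_sheaf_diagram_def finite_sheaf_diagram_axioms_def)
  then show "\<exists>x \<pi>. is_limit J (sheaf_cat C K) T x \<pi>"
    using finite_sheaf_diagram.limit by blast
qed

section \<open>Totally connected geometric morphisms\<close>

lemma grothendieck_topos_finite_limits:
  assumes U: "universe_type TYPE('u)" and E: "grothendieck_topos TYPE('u) E"
  shows "has_finite_limits E" and "category_with_pullbacks E"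
proof -
  from E obtain C :: "('u, 'u) cat" and K where C: "category C" "grothendieck_topology C K"
    and equiv: "equivalent E (sheaf_cat C K :: (('u, 'u, 'u) presheaf,
      ('u, 'u, 'u) presheaf \<times> ('u \<Rightarrow> 'u smap) \<times> ('u, 'u, 'u) presheaf) cat)"
    unfolding grothendieck_topos_def small_category_def by blast
  show lim: "has_finite_limits E"
    by (rule has_finite_limits_if_equivalent[OF equiv sheaf_cat_has_finite_limits[OF U C]])
  have "category E"
    using E by (simp add: grothendieck_topos_def)
  with lim show "category_with_pullbacks E"
    by (simp add: category_with_pullbacks_def category_with_pullbacks_axioms_def has_finite_limits_pullback)
qed

lemma essential_shriek_adjunction:
  assumes "essential F E f"
  obtains \<eta> where "adjunction F E (shriek F E f) (inv_im f) \<eta> (shriek_counit F E f)"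
proof -
  have "\<exists>t. case t of (L, \<eta>, \<epsilon>) \<Rightarrow> adjunction F E L (inv_im f) \<eta> \<epsilon>"
    using assms by (auto simp: essential_def)
  then have "case shriek_adj F E f of (L, \<eta>, \<epsilon>) \<Rightarrow> adjunction F E L (inv_im f) \<eta> \<epsilon>"
    unfolding shriek_adj_def by (rule someI_ex)
  then show thesis
    by (intro that[of "fst (snd (shriek_adj F E f))"])
      (simp add: shriek_def shriek_counit_def case_prod_unfold)
qed

lemma locally_connected_iff_street_fibration:
  assumes F: "category_with_pullbacks F" and E: "category_with_pullbacks E" and ess: "essential F E f"
  shows "locally_connected F E f \<longleftrightarrow> street_fibration F E (shriek F E f)"
proof -
  obtain \<eta> where adj: "adjunction F E (shriek F E f) (inv_im f) \<eta> (shriek_counit F E f)"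
    by (rule essential_shriek_adjunction[OF ess])
  then have "is_functor F E (shriek F E f)" "is_functor E F (inv_im f)"
    by (simp_all add: adjunction_def)
  then have "functor_between F E (shriek F E f)" "functor_between E F (inv_im f)"
    by (simp_all add: functor_betweenI)
  with F E adj interpret essential_morphism F E f \<eta>
    by (simp add: essential_morphism_def left_adjoint_def left_adjoint_axioms_def)
  show ?thesis
    using ess comparisons_nat_iso_iff_street_fibration by (simp add: locally_connected_def)
qed

theorem proposition5p4p1:
  fixes E :: "('o, 'm) cat" and F :: "('p, 'n) cat" and f :: "('p, 'n, 'o, 'm) geom"
  assumes "universe_type TYPE('u)"
    and "grothendieck_topos TYPE('u) E"
    and "grothendieck_topos TYPE('u) F"
    and "geometric_morphism F E f"
  shows "totally_connected F E f \<longleftrightarrow>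
    essential F E f \<and> cartesian_fibration F E (shriek F E f)"
proof -
  note E = grothendieck_topos_finite_limits[OF assms(1,2)]
    and F = grothendieck_topos_finite_limits[OF assms(1,3)]
  have "locally_connected F E f \<longleftrightarrow> essential F E f \<and> street_fibration F E (shriek F E f)"
    using locally_connected_iff_street_fibration[OF F(2) E(2)] by (auto simp: locally_connected_def)
  then show ?thesis
    using E(1) F(1) by (auto simp: totally_connected_def cartesian_fibration_def)
qed

end
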